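(* Let $E$ be a Banach space, and for each $k\ge0$ let $E^k=E^{\otimes k}$ (with $E^0=\mathbb R$) be equipped with a cross-norm $\|\cdot\|_k$ (completed) such that $$\|u\otimes v\|_{k+m}\le\|u\|_k\|v\|_m\qquad\text{for all }u\in E^k,\ v\in E^m .$$ Let $0<T<\infty$, let $n\ge0$ be an integer and $\alpha>1/(n+1)$. For every $0\le k\le n$ let $(a,b)\mapsto X^{(k)}_{ab}$ be an $E^k$-valued function defined for $0\le a\le b<T$, with $X^{(0)}_{ab}=1$, such that $$X^{(k)}_{ab}=\sum_{i=0}^kX^{(i)}_{ac}\otimes X^{(k-i)}_{cb}\qquad\text{for all }a\le c\le b,$$ and suppose that for some constant $M$ and all $k\le n$ $$\|X^{(k)}_{ab}\|_k\le M|b-a|^{k\alpha}\qquad\text{for all }a\le b.$$ Then there exists a unique family of $E^k$-valued functions $(a,b)\mapsto Y^{(k)}_{ab}$, $k\ge0$, $0\le a\le b<T$, such that $Y^{(k)}=X^{(k)}$ for $k\le n$, $$Y^{(k)}_{ab}=\sum_{i=0}^kY^{(i)}_{ac}\otimes Y^{(k-i)}_{cb}$$ for every $k\ge 0$ and every $a\le c\le b$, and, for some constant $C$, $$\sum_{k\ge n+1}\|Y^{(k)}_{ab}\|_k\le C\,|b-a|^{(n+1)\alpha}\qquad\text{for all }0\le a\le b<T.$$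
   Context: $E^k$ denotes the $k$-fold tensor power of $E$, completed for the norm $\|\cdot\|_k$; the norm on $E^0=\mathbb R$ is the absolute value and the norm on $E^1=E$ is the given one. *)

theory Defs
  imports "HOL-Analysis.Analysis" "HOL-Library.Poly_Mapping"
begin

subsection \<open>Algebraic tensor powers\<close>

text \<open>The finitely supported functions \<^typ>\<open>'e list \<Rightarrow>\<^sub>0 real\<close> are the free real vector space on the
  words over \<open>E\<close>; a word of length \<open>k\<close> stands for a formal tensor \<open>e\<^sub>1 \<otimes> \<dots> \<otimes> e\<^sub>k\<close>.\<close>

instantiation poly_mapping :: (type, real_vector) real_vector
begin

lift_definition scaleR_poly_mapping :: "real \<Rightarrow> ('a \<Rightarrow>\<^sub>0 'b) \<Rightarrow> ('a \<Rightarrow>\<^sub>0 'b)"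
  is "\<lambda>c f x. c *\<^sub>R f x"
  by (erule finite_subset[rotated]) auto

instance
  by standard (transfer; simp add: fun_eq_iff scaleR_add_right scaleR_add_left)+

end

definition word :: "'e list \<Rightarrow> ('e list \<Rightarrow>\<^sub>0 real)"
  where "word es = Poly_Mapping.single es 1"

definition multilinear_relators :: "('e::real_vector list \<Rightarrow>\<^sub>0 real) set"
  where "multilinear_relators =
    {word (es @ (x + y) # fs) - word (es @ x # fs) - word (es @ y # fs) | es x y fs. True} \<union>
    {word (es @ (c *\<^sub>R x) # fs) - c *\<^sub>R word (es @ x # fs) | es c x fs. True}"

text \<open>All relators are homogeneous for word length, so the quotient is the direct sum over \<open>k\<close> of the
  algebraic tensor powers of \<open>E\<close>, the \<open>k\<close>-th one being spanned by the classes of words of length \<open>k\<close>.\<close>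

quotient_type (overloaded) 'e tensor_algebra =
  "'e::real_vector list \<Rightarrow>\<^sub>0 real" / "\<lambda>p q. p - q \<in> span multilinear_relators"
proof (rule equivpI)
  show "reflp (\<lambda>p q. p - q \<in> span (multilinear_relators :: ('e list \<Rightarrow>\<^sub>0 real) set))"
    by (rule reflpI) (simp add: span_zero)
  show "symp (\<lambda>p q. p - q \<in> span (multilinear_relators :: ('e list \<Rightarrow>\<^sub>0 real) set))"
    by (rule sympI) (metis minus_diff_eq span_neg)
  show "transp (\<lambda>p q. p - q \<in> span (multilinear_relators :: ('e list \<Rightarrow>\<^sub>0 real) set))"
  proof (rule transpI)
    fix x y z :: "'e list \<Rightarrow>\<^sub>0 real"
    assume "x - y \<in> span multilinear_relators" "y - z \<in> span multilinear_relators"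
    then have "(x - y) + (y - z) \<in> span multilinear_relators"
      by (rule span_add)
    then show "x - z \<in> span multilinear_relators"
      by simp
  qed
qed

instantiation tensor_algebra :: (real_vector) real_vector
begin

lift_definition zero_tensor_algebra :: "'a tensor_algebra" is 0 .

lift_definition plus_tensor_algebra ::
    "'a tensor_algebra \<Rightarrow> 'a tensor_algebra \<Rightarrow> 'a tensor_algebra" is "(+)"
  by (subst add_diff_add) (rule span_add)

lift_definition minus_tensor_algebra ::
    "'a tensor_algebra \<Rightarrow> 'a tensor_algebra \<Rightarrow> 'a tensor_algebra" is "(-)"
proof -
  fix p p' q q' :: "'a list \<Rightarrow>\<^sub>0 real"
  assume "p - p' \<in> span multilinear_relators" "q - q' \<in> span multilinear_relators"
  then have "(p - p') - (q - q') \<in> span multilinear_relators"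
    by (rule span_diff)
  then show "(p - q) - (p' - q') \<in> span multilinear_relators"
    by (simp add: algebra_simps)
qed

lift_definition uminus_tensor_algebra :: "'a tensor_algebra \<Rightarrow> 'a tensor_algebra" is uminus
  by (subst minus_diff_minus) (rule span_neg)

lift_definition scaleR_tensor_algebra :: "real \<Rightarrow> 'a tensor_algebra \<Rightarrow> 'a tensor_algebra"
  is scaleR
  by (subst scaleR_diff_right[symmetric]) (rule span_scale)

instance
  by standard
    (transfer; simp add: span_zero scaleR_add_right scaleR_add_left algebra_simps)+

end

lift_definition pure_tensor :: "'e::real_vector list \<Rightarrow> 'e tensor_algebra" is word .

definition tensor_power :: "nat \<Rightarrow> 'e::real_vector tensor_algebra set"
  where "tensor_power k = span {pure_tensor es | es. length es = k}"


subsection \<open>Cross-norms and completion\<close>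

definition norm_on :: "'v::real_vector set \<Rightarrow> ('v \<Rightarrow> real) \<Rightarrow> bool"
  where "norm_on V N \<longleftrightarrow> subspace V \<and>
    (\<forall>u\<in>V. 0 \<le> N u \<and> (N u = 0 \<longleftrightarrow> u = 0)) \<and>
    (\<forall>c. \<forall>u\<in>V. N (c *\<^sub>R u) = \<bar>c\<bar> * N u) \<and>
    (\<forall>u\<in>V. \<forall>v\<in>V. N (u + v) \<le> N u + N v)"

definition banach_on :: "'v::real_vector set \<Rightarrow> ('v \<Rightarrow> real) \<Rightarrow> bool"
  where "banach_on V N \<longleftrightarrow> norm_on V N \<and>
    (\<forall>s. (\<forall>i::nat. s i \<in> V) \<and> (\<forall>e>0. \<exists>i0. \<forall>i\<ge>i0. \<forall>j\<ge>i0. N (s i - s j) < e) \<longrightarrow>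
      (\<exists>v\<in>V. (\<lambda>i. N (s i - v)) \<longlonglongrightarrow> 0))"

text \<open>For \<open>k = 0\<close> (empty product) this says that the norm on the line spanned by the empty tensor is the
  absolute value, and for \<open>k = 1\<close> that it is the given norm of \<open>E\<close>.\<close>

definition cross_norm :: "nat \<Rightarrow> ('e::real_normed_vector tensor_algebra \<Rightarrow> real) \<Rightarrow> bool"
  where "cross_norm k p \<longleftrightarrow> norm_on (tensor_power k) p \<and>
    (\<forall>es. length es = k \<longrightarrow> p (pure_tensor es) = (\<Prod>e\<leftarrow>es. norm e))"

text \<open>\<open>(V, N)\<close> together with the embedding \<open>\<iota>\<close> is a completion of the normed space \<open>(W, p)\<close>.\<close>

definition is_completion ::
    "'w::real_vector set \<Rightarrow> ('w \<Rightarrow> real) \<Rightarrow> 'v::real_vector set \<Rightarrow> ('v \<Rightarrow> real) \<Rightarrow> ('w \<Rightarrow> 'v) \<Rightarrow> bool"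
  where "is_completion W p V N \<iota> \<longleftrightarrow> norm_on W p \<and> banach_on V N \<and>
    (\<forall>s\<in>W. \<iota> s \<in> V \<and> N (\<iota> s) = p s) \<and>
    (\<forall>s\<in>W. \<forall>t\<in>W. \<iota> (s + t) = \<iota> s + \<iota> t) \<and>
    (\<forall>c. \<forall>s\<in>W. \<iota> (c *\<^sub>R s) = c *\<^sub>R \<iota> s) \<and>
    (\<forall>v\<in>V. \<forall>e>0. \<exists>s\<in>W. N (v - \<iota> s) < e)"

text \<open>\<open>V k\<close> with norm \<open>N k\<close> is the completion of the algebraic tensor power for the cross-norm \<open>p k\<close>.
  The spaces \<open>V k\<close> are subspaces of one ambient real vector space only to give them a common type;
  nothing is assumed about how they intersect, and the ambient space carries no norm.
  Being bilinear, concatenation on pure tensors and contractive, \<open>tens k m\<close> is the unique continuous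
  extension of the algebraic product to \<open>V k \<times> V m\<close>.\<close>

locale completed_tensor_powers =
  fixes p :: "nat \<Rightarrow> 'e::banach tensor_algebra \<Rightarrow> real"
    and V :: "nat \<Rightarrow> 'v::real_vector set"
    and N :: "nat \<Rightarrow> 'v \<Rightarrow> real"
    and \<iota> :: "nat \<Rightarrow> 'e tensor_algebra \<Rightarrow> 'v"
    and tens :: "nat \<Rightarrow> nat \<Rightarrow> 'v \<Rightarrow> 'v \<Rightarrow> 'v"
  assumes cross_norm: "cross_norm k (p k)"
    and completion: "is_completion (tensor_power k) (p k) (V k) (N k) (\<iota> k)"
    and tens_closed: "u \<in> V k \<Longrightarrow> v \<in> V m \<Longrightarrow> tens k m u v \<in> V (k + m)"
    and tens_add_left: "u \<in> V k \<Longrightarrow> u' \<in> V k \<Longrightarrow> v \<in> V m \<Longrightarrow>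
      tens k m (u + u') v = tens k m u v + tens k m u' v"
    and tens_add_right: "u \<in> V k \<Longrightarrow> v \<in> V m \<Longrightarrow> v' \<in> V m \<Longrightarrow>
      tens k m u (v + v') = tens k m u v + tens k m u v'"
    and tens_scale_left: "u \<in> V k \<Longrightarrow> v \<in> V m \<Longrightarrow> tens k m (c *\<^sub>R u) v = c *\<^sub>R tens k m u v"
    and tens_scale_right: "u \<in> V k \<Longrightarrow> v \<in> V m \<Longrightarrow> tens k m u (c *\<^sub>R v) = c *\<^sub>R tens k m u v"
    and tens_pure: "length es = k \<Longrightarrow> length fs = m \<Longrightarrow>
      tens k m (\<iota> k (pure_tensor es)) (\<iota> m (pure_tensor fs)) = \<iota> (k + m) (pure_tensor (es @ fs))"
    and tens_norm: "u \<in> V k \<Longrightarrow> v \<in> V m \<Longrightarrow> N (k + m) (tens k m u v) \<le> N k u * N m v"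


subsection \<open>Multiplicative families\<close>

text \<open>The library has \<open>0 powr 0 = 0\<close>; the bound at \<open>k = 0\<close> on the diagonal needs \<open>0\<^sup>0 = 1\<close>.\<close>

definition rpow :: "real \<Rightarrow> real \<Rightarrow> real"
  where "rpow x s = (if s = 0 then 1 else x powr s)"

definition chen_relation ::
    "(nat \<Rightarrow> nat \<Rightarrow> 'v::real_vector \<Rightarrow> 'v \<Rightarrow> 'v) \<Rightarrow> real \<Rightarrow> (nat \<Rightarrow> real \<Rightarrow> real \<Rightarrow> 'v) \<Rightarrow> nat \<Rightarrow> bool"
  where "chen_relation tens T X k \<longleftrightarrow>
    (\<forall>a b c. 0 \<le> a \<longrightarrow> a \<le> c \<longrightarrow> c \<le> b \<longrightarrow> b < T \<longrightarrow>
      X k a b = (\<Sum>i=0..k. tens i (k - i) (X i a c) (X (k - i) c b)))"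

text \<open>The sum over \<open>k \<ge> n + 1\<close> is indexed by \<open>k = n + 1 + j\<close>; \<open>summable\<close> is what makes its
  being bounded meaningful.\<close>

definition multiplicative_extension ::
    "(nat \<Rightarrow> 'v::real_vector set) \<Rightarrow> (nat \<Rightarrow> 'v \<Rightarrow> real) \<Rightarrow> (nat \<Rightarrow> nat \<Rightarrow> 'v \<Rightarrow> 'v \<Rightarrow> 'v) \<Rightarrow>
     real \<Rightarrow> real \<Rightarrow> nat \<Rightarrow> (nat \<Rightarrow> real \<Rightarrow> real \<Rightarrow> 'v) \<Rightarrow> (nat \<Rightarrow> real \<Rightarrow> real \<Rightarrow> 'v) \<Rightarrow> bool"
  where "multiplicative_extension V N tens T \<alpha> n X Y \<longleftrightarrow>
    (\<forall>k a b. 0 \<le> a \<longrightarrow> a \<le> b \<longrightarrow> b < T \<longrightarrow> Y k a b \<in> V k) \<and>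
    (\<forall>k\<le>n. \<forall>a b. 0 \<le> a \<longrightarrow> a \<le> b \<longrightarrow> b < T \<longrightarrow> Y k a b = X k a b) \<and>
    (\<forall>k. chen_relation tens T Y k) \<and>
    (\<exists>C. \<forall>a b. 0 \<le> a \<longrightarrow> a \<le> b \<longrightarrow> b < T \<longrightarrow>
      summable (\<lambda>j. N (n + 1 + j) (Y (n + 1 + j) a b)) \<and>
      suminf (\<lambda>j. N (n + 1 + j) (Y (n + 1 + j) a b)) \<le> C * rpow \<bar>b - a\<bar> (real (n + 1) * \<alpha>))"

end

theory Submission
  imports Defs
begin

text \<open>Both halves reduce to the top level \<open>k\<close> when all lower levels are known. Because \<open>Y\<^sup>(\<^sup>0\<^sup>) = 1\<close>,
  the Chen relation at level \<open>k\<close> says that \<open>Y\<^sup>(\<^sup>k\<^sup>)\<close> is additive up to the mixed term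
  \<open>W a c b = (\<Sum>i=1..<k. Y i a c \<otimes> Y (k - i) c b)\<close>, which involves lower levels only.

  Uniqueness: the difference of two solutions with the same lower levels is additive in the interval
  and bounded by a multiple of \<open>(b - a) powr \<theta>\<close> with \<open>\<theta> = (n + 1) * \<alpha> > 1\<close>; repeated bisection forces
  it to vanish (\<open>midpoint_improvement\<close> with constant \<open>0\<close>, used in \<open>extension_unique\<close>).

  Existence: associativity of the product makes \<open>W\<close> a cocycle (\<open>mixed_cocycle\<close>). Fixing its first
  argument to be \<open>0\<close> turns it into a germ \<open>W 0 a b\<close> of two variables whose additivity defect is
  \<open>- W a c b\<close>, of size \<open>(b - a) powr (k * \<alpha>)\<close>. As \<open>k * \<alpha> > 1\<close>, the additive sewing lemma
  (\<open>sewing\<close>) yields a path \<open>Z\<close> whose increments are close to the germ, and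
  \<open>Z b - Z a - W 0 a b\<close> is the wanted level \<open>k\<close> (\<open>extend_level\<close>).

  Summability over \<open>k\<close> needs control of the constants. Whatever constant sewing delivers, bisection
  improves it to \<open>1 / (2 powr (k * \<alpha>) - 2)\<close> times the constant of the mixed term at a midpoint. That
  denominator grows geometrically, which leaves room for bounds \<open>c k\<close> decaying like
  \<open>B ^ k / (k!) powr (\<alpha> / 2)\<close> (\<open>extension_constants\<close>): the loss in the convolution
  \<open>\<Sum>i=1..<k. c i * c (k - i)\<close> is only \<open>k * 2 powr (k * \<alpha> / 2)\<close>, by \<open>k choose i \<le> 2 ^ k\<close>. With such
  constants the series converges on intervals of every length.\<close>

section \<open>Banach subspaces and sewing\<close>

lemma sum_even_odd: "(\<Sum>j<2 * m. f j) = (\<Sum>j<m. f (2 * j) + f (Suc (2 * j)))"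
  for f :: "nat \<Rightarrow> 'a::comm_monoid_add"
  by (induction m) (auto simp: add.assoc)

text \<open>The levels live in one ambient vector space without a norm, each with its own partial norm, so
  the type classes of normed and Banach spaces do not apply to them; this locale plays their part.\<close>
locale banach_subspace =
  fixes V :: "'v::real_vector set" and N :: "'v \<Rightarrow> real"
  assumes banach: "banach_on V N"
begin

lemma norm_on: "norm_on V N"
  using banach by (simp add: banach_on_def)

lemma subspace: "subspace V"
  using norm_on by (simp add: norm_on_def)

lemmas zero_mem [simp] = subspace_0 [OF subspace]
  and add_mem [simp] = subspace_add [OF subspace]
  and diff_mem [simp] = subspace_diff [OF subspace]
  and neg_mem [simp] = subspace_neg [OF subspace]
  and scale_mem [simp] = subspace_scale [OF subspace]
  and sum_mem = subspace_sum [OF subspace]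

lemma norm_nonneg: "u \<in> V \<Longrightarrow> 0 \<le> N u"
  and norm_eq_0_iff: "u \<in> V \<Longrightarrow> N u = 0 \<longleftrightarrow> u = 0"
  and norm_scale: "u \<in> V \<Longrightarrow> N (c *\<^sub>R u) = \<bar>c\<bar> * N u"
  and norm_triangle: "u \<in> V \<Longrightarrow> v \<in> V \<Longrightarrow> N (u + v) \<le> N u + N v"
  using norm_on unfolding norm_on_def by blast+

lemma norm_zero [simp]: "N 0 = 0"
  by (simp add: norm_eq_0_iff)

lemma norm_neg: "u \<in> V \<Longrightarrow> N (- u) = N u"
  using norm_scale [of u "-1"] by simp

lemma norm_minus_commute: "u \<in> V \<Longrightarrow> v \<in> V \<Longrightarrow> N (u - v) = N (v - u)"
  using norm_neg [of "u - v"] by simp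

lemma norm_diff_le: "u \<in> V \<Longrightarrow> v \<in> V \<Longrightarrow> N (u - v) \<le> N u + N v"
  using norm_triangle [of u "- v"] by (simp add: norm_neg)

lemma norm_sum_le:
  assumes "\<And>i. i \<in> A \<Longrightarrow> f i \<in> V" "\<And>i. i \<in> A \<Longrightarrow> N (f i) \<le> g i"
  shows "N (sum f A) \<le> sum g A"
  using assms
proof (induction A rule: infinite_finite_induct)
  case (insert i A)
  have "N (f i + sum f A) \<le> N (f i) + N (sum f A)"
    using insert by (intro norm_triangle sum_mem) auto
  also have "\<dots> \<le> g i + sum g A"
    using insert by (intro add_mono) auto
  finally show ?case
    using insert by simp
qed auto

lemma summable_steps_converge:
  assumes mem: "\<And>i. s i \<in> V"
    and step: "\<And>i. N (s (Suc i) - s i) \<le> e i"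
    and "summable e"
  shows "\<exists>v\<in>V. (\<lambda>i. N (s i - v)) \<longlonglongrightarrow> 0"
proof -
  have tele: "N (s j - s i) \<le> sum e {i..<j}" if "i \<le> j" for i j
  proof -
    have "s j - s i = (\<Sum>l=i..<j. s (Suc l) - s l)"
      using that by (simp add: sum_Suc_diff')
    then show ?thesis
      using norm_sum_le [of "{i..<j}" "\<lambda>l. s (Suc l) - s l" e] mem step by simp
  qed
  have "\<exists>i0. \<forall>i\<ge>i0. \<forall>j\<ge>i0. N (s i - s j) < d" if "d > 0" for d
  proof -
    from \<open>summable e\<close> that obtain i0 where i0: "\<And>i j. i \<ge> i0 \<Longrightarrow> norm (sum e {i..<j}) < d"
      unfolding summable_Cauchy by blast
    have "N (s j - s i) < d" if "i \<ge> i0" "i \<le> j" for i j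
      using tele [OF that(2)] i0 [OF that(1), of j] by (simp add: abs_less_iff)
    then show ?thesis
      by (metis nle_le norm_minus_commute mem)
  qed
  with banach mem show ?thesis
    unfolding banach_on_def by blast
qed

text \<open>Bisecting \<open>m\<close> times costs \<open>K / (2 powr \<theta> - 2) * (1 - r ^ m)\<close> for the correction terms and leaves
  \<open>2 ^ m\<close> intervals of length \<open>(b - a) / 2 ^ m\<close>, on which the a priori bound contributes \<open>S * r ^ m\<close>,
  where \<open>r = 2 / 2 powr \<theta> < 1\<close>. Hence the a priori constant \<open>S\<close> disappears in the limit.\<close>
lemma midpoint_improvement:
  fixes R :: "real \<Rightarrow> real \<Rightarrow> 'v" and W :: "real \<Rightarrow> real \<Rightarrow> real \<Rightarrow> 'v"
  assumes \<theta>: "1 < \<theta>"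
    and memR: "\<And>a b. 0 \<le> a \<Longrightarrow> a \<le> b \<Longrightarrow> b < T \<Longrightarrow> R a b \<in> V"
    and split: "\<And>a c b. 0 \<le> a \<Longrightarrow> a \<le> c \<Longrightarrow> c \<le> b \<Longrightarrow> b < T \<Longrightarrow> R a b = R a c + R c b + W a c b"
    and W: "\<And>a b. 0 \<le> a \<Longrightarrow> a \<le> b \<Longrightarrow> b < T \<Longrightarrow>
      N (W a ((a + b) / 2) b) \<le> K * ((b - a) / 2) powr \<theta>"
    and R: "\<And>a b. 0 \<le> a \<Longrightarrow> a \<le> b \<Longrightarrow> b < T \<Longrightarrow> N (R a b) \<le> S * (b - a) powr \<theta>"
    and ab: "0 \<le> a" "a \<le> b" "b < T"
  shows "N (R a b) \<le> K / (2 powr \<theta> - 2) * (b - a) powr \<theta>"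
proof -
  define r where "r = 2 / 2 powr \<theta>"
  define Q where "Q = K / (2 powr \<theta> - 2)"
  have two: "2 < 2 powr \<theta>"
    using \<theta> powr_less_mono [of 1 \<theta> 2] by simp
  have Q: "(2 * Q + K) / 2 powr \<theta> = Q"
    using two unfolding Q_def by (simp add: field_simps)
  have r: "0 \<le> r" "r < 1"
    using two by (auto simp: r_def)
  have iter: "N (R a b) \<le> (Q + (S - Q) * r ^ m) * (b - a) powr \<theta>"
    if "0 \<le> a" "a \<le> b" "b < T" for a b m
    using that
  proof (induction m arbitrary: a b)
    case 0
    then show ?case using R by simp
  next
    case (Suc m)
    let ?c = "(a + b) / 2"
    let ?A = "Q + (S - Q) * r ^ m"
    have c: "a \<le> ?c" "?c \<le> b" "0 \<le> ?c" "?c < T"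
      using Suc.prems by (auto simp: field_simps)
    have lens: "?c - a = (b - a) / 2" "b - ?c = (b - a) / 2"
      by (auto simp: field_simps)
    have memW: "W a ?c b \<in> V"
    proof -
      have "W a ?c b = R a b - (R a ?c + R ?c b)"
        using split [of a ?c b] Suc.prems c by simp
      then show ?thesis
        using memR Suc.prems c by (auto intro!: diff_mem add_mem)
    qed
    have mems: "R a ?c \<in> V" "R ?c b \<in> V"
      using memR Suc.prems c by auto
    have "N (R a b) \<le> N (R a ?c + R ?c b) + N (W a ?c b)"
      using split [of a ?c b] Suc.prems c mems memW norm_triangle add_mem by metis
    also have "\<dots> \<le> N (R a ?c) + N (R ?c b) + N (W a ?c b)"
      using norm_triangle [OF mems] by simp
    also have "\<dots> \<le> ?A * ((b - a) / 2) powr \<theta> + ?A * ((b - a) / 2) powr \<theta>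
        + K * ((b - a) / 2) powr \<theta>"
      using Suc.IH [of a ?c] Suc.IH [of ?c b] W [of a b] Suc.prems c
      unfolding lens by (intro add_mono) auto
    also have "\<dots> = (2 * ?A + K) / 2 powr \<theta> * (b - a) powr \<theta>"
      using Suc.prems by (simp add: powr_divide field_simps)
    also have "(2 * ?A + K) / 2 powr \<theta> = (2 * Q + K) / 2 powr \<theta> + (S - Q) * r ^ m * (2 / 2 powr \<theta>)"
      by (simp add: field_simps)
    also have "(S - Q) * r ^ m * (2 / 2 powr \<theta>) = (S - Q) * r ^ Suc m"
      unfolding r_def [symmetric] by simp
    finally show ?case
      unfolding Q .
  qed
  have "(\<lambda>m. (Q + (S - Q) * r ^ m) * (b - a) powr \<theta>) \<longlonglongrightarrow> (Q + (S - Q) * 0) * (b - a) powr \<theta>"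
    using r by (intro tendsto_intros LIMSEQ_realpow_zero)
  then have "(\<lambda>m. (Q + (S - Q) * r ^ m) * (b - a) powr \<theta>) \<longlonglongrightarrow> Q * (b - a) powr \<theta>"
    by simp
  then show ?thesis
    unfolding Q_def [symmetric] by (rule LIMSEQ_le_const) (use iter ab in blast)
qed

text \<open>Induction on the number of cells. The cell containing the midpoint of the interval is cut out; the
  two remaining parts have at most half the length, so their errors add up to the fraction
  \<open>2 / 2 powr \<theta> < 1\<close> of the claimed bound, and the gap is exactly what two defects need.\<close>
lemma partition_bound:
  fixes \<Xi> :: "real \<Rightarrow> real \<Rightarrow> 'v" and x :: "nat \<Rightarrow> real"
  assumes \<theta>: "1 < \<theta>" and K: "0 \<le> K"
    and mem: "\<And>a b. 0 \<le> a \<Longrightarrow> a \<le> b \<Longrightarrow> b < T \<Longrightarrow> \<Xi> a b \<in> V"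
    and diag: "\<And>a. 0 \<le> a \<Longrightarrow> a < T \<Longrightarrow> \<Xi> a a = 0"
    and defect: "\<And>a c b. 0 \<le> a \<Longrightarrow> a \<le> c \<Longrightarrow> c \<le> b \<Longrightarrow> b < T \<Longrightarrow>
      N (\<Xi> a b - \<Xi> a c - \<Xi> c b) \<le> K * (b - a) powr \<theta>"
    and x: "mono x" "\<And>j. 0 \<le> x j" "\<And>j. x j < T"
    and "p \<le> q"
  shows "N ((\<Sum>j=p..<q. \<Xi> (x j) (x (Suc j))) - \<Xi> (x p) (x q))
    \<le> 2 * K * 2 powr \<theta> / (2 powr \<theta> - 2) * (x q - x p) powr \<theta>"
  using \<open>p \<le> q\<close>
proof (induction "q - p" arbitrary: p q rule: less_induct)
  case less
  let ?S = "\<lambda>p q. \<Sum>j=p..<q. \<Xi> (x j) (x (Suc j))"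
  define C where "C = 2 * K * 2 powr \<theta> / (2 powr \<theta> - 2)"
  have two: "2 < 2 powr \<theta>"
    using \<theta> powr_less_mono [of 1 \<theta> 2] by simp
  have C0: "0 \<le> C" and C: "2 * C / 2 powr \<theta> + 2 * K = C"
    using two K unfolding C_def by (auto simp: field_simps)
  have memx: "\<Xi> (x i) (x j) \<in> V" if "i \<le> j" for i j
    using mem x that by (meson monoD)
  have memS: "?S i j \<in> V" for i j
    by (intro sum_mem memx) auto
  show ?case
  proof (cases "p = q")
    case True
    then show ?thesis using diag x by simp
  next
    case False
    define mid where "mid = (x p + x q) / 2"
    have pq: "p < q" using False less.prems by simp
    have xpq: "x p \<le> x q" using monoD [OF x(1)] pq by simp
    \<comment> \<open>The cell from \<open>x r\<close> to \<open>x (Suc r)\<close> contains the midpoint.\<close>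
    define r where "r = Max {i\<in>{p..<q}. x i \<le> mid}"
    have "p \<in> {i\<in>{p..<q}. x i \<le> mid}"
      using pq xpq by (simp add: mid_def)
    then have "r \<in> {i\<in>{p..<q}. x i \<le> mid}"
      unfolding r_def by (intro Max_in) auto
    then have r: "p \<le> r" "r < q" "x r \<le> mid"
      by auto
    have "mid \<le> x (Suc r)"
    proof (cases "Suc r = q")
      case True
      then show ?thesis using xpq by (simp add: mid_def)
    next
      case False
      show ?thesis
      proof (rule ccontr)
        assume "\<not> ?thesis"
        then have "Suc r \<in> {i\<in>{p..<q}. x i \<le> mid}"
          using False r by auto
        then have "Suc r \<le> r"
          unfolding r_def by (intro Max_ge) auto
        then show False by simp
      qed
    qed
    then have halves: "x r - x p \<le> (x q - x p) / 2" "x q - x (Suc r) \<le> (x q - x p) / 2"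
      using r by (auto simp: mid_def field_simps)
    have mono: "x p \<le> x r" "x r \<le> x (Suc r)" "x (Suc r) \<le> x q"
      using monoD [OF x(1)] r by auto
    let ?L = "(x q - x p) powr \<theta>"
    let ?d1 = "\<Xi> (x p) (x q) - \<Xi> (x p) (x r) - \<Xi> (x r) (x q)"
    let ?d2 = "\<Xi> (x r) (x q) - \<Xi> (x r) (x (Suc r)) - \<Xi> (x (Suc r)) (x q)"
    let ?e1 = "?S p r - \<Xi> (x p) (x r)"
    let ?e2 = "?S (Suc r) q - \<Xi> (x (Suc r)) (x q)"
    have mems: "?d1 \<in> V" "?d2 \<in> V" "?e1 \<in> V" "?e2 \<in> V"
      using r by (auto intro!: diff_mem memx memS)
    have half: "C * (u powr \<theta>) \<le> C / 2 powr \<theta> * ?L" if "0 \<le> u" "u \<le> (x q - x p) / 2" for u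
    proof -
      have "u powr \<theta> \<le> ((x q - x p) / 2) powr \<theta>"
        using that \<theta> by (intro powr_mono2) auto
      then have "C * u powr \<theta> \<le> C * ((x q - x p) / 2) powr \<theta>"
        using C0 by (rule mult_left_mono)
      then show ?thesis
        using xpq by (simp add: powr_divide)
    qed
    have e1: "N ?e1 \<le> C / 2 powr \<theta> * ?L"
    proof (rule order_trans)
      show "N ?e1 \<le> C * (x r - x p) powr \<theta>"
        unfolding C_def using r by (intro less.hyps) auto
    qed (use half halves mono in auto)
    have e2: "N ?e2 \<le> C / 2 powr \<theta> * ?L"
    proof (rule order_trans)
      show "N ?e2 \<le> C * (x q - x (Suc r)) powr \<theta>"
        unfolding C_def using r by (intro less.hyps) auto
    qed (use half [of "x q - x (Suc r)"] halves mono in auto)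
    have d1: "N ?d1 \<le> K * ?L"
      using defect [of "x p" "x r" "x q"] x mono by simp
    have d2: "N ?d2 \<le> K * ?L"
    proof -
      have "N ?d2 \<le> K * (x q - x r) powr \<theta>"
        using defect [of "x r" "x (Suc r)" "x q"] x mono by simp
      also have "\<dots> \<le> K * ?L"
        using mono K \<theta> by (intro mult_left_mono powr_mono2) auto
      finally show ?thesis .
    qed
    have "?S p q = ?S p r + \<Xi> (x r) (x (Suc r)) + ?S (Suc r) q"
    proof -
      have "?S p q = ?S p r + ?S r q"
        using r by (simp add: sum.atLeastLessThan_concat)
      then show ?thesis
        using r by (simp add: sum.atLeast_Suc_lessThan add.assoc)
    qed
    then have "?S p q - \<Xi> (x p) (x q) = (?e1 + ?e2) - (?d1 + ?d2)"
      by (simp add: algebra_simps)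
    also have "N \<dots> \<le> N (?e1 + ?e2) + N (?d1 + ?d2)"
      by (intro norm_diff_le add_mem mems)
    also have "\<dots> \<le> (N ?e1 + N ?e2) + (N ?d1 + N ?d2)"
      by (intro add_mono norm_triangle mems)
    also have "\<dots> \<le> (C / 2 powr \<theta> * ?L + C / 2 powr \<theta> * ?L) + (K * ?L + K * ?L)"
      by (intro add_mono e1 e2 d1 d2)
    also have "\<dots> = (2 * C / 2 powr \<theta> + 2 * K) * ?L"
      by (simp add: algebra_simps)
    finally show ?thesis
      unfolding C C_def [symmetric] .
  qed
qed

text \<open>\<open>Z t\<close> is the limit of the germ sums along the dyadic partitions of \<open>[0, T]\<close> stopped at \<open>t\<close>. Truncating
  the grid by \<open>min t\<close> keeps the index set \<open>{..<2 ^ m}\<close> independent of \<open>t\<close>: cells to the right of \<open>t\<close>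
  contribute \<open>\<Xi> t t = 0\<close>. Since \<open>2 ^ m\<close> cells with defect \<open>K * (T / 2 ^ m) powr \<theta>\<close> have the summable
  total \<open>e m\<close>, the sums converge. For the estimate, the sum stopped at \<open>b\<close> minus the sum stopped at
  \<open>a\<close> is, up to \<open>e m\<close>, the sum over the grid clamped to \<open>[a, b]\<close>, to which
  \<open>partition_bound\<close> applies.\<close>
lemma sewing:
  fixes \<Xi> :: "real \<Rightarrow> real \<Rightarrow> 'v"
  assumes \<theta>: "1 < \<theta>" and K: "0 \<le> K" and T: "0 < T"
    and mem: "\<And>a b. 0 \<le> a \<Longrightarrow> a \<le> b \<Longrightarrow> b < T \<Longrightarrow> \<Xi> a b \<in> V"
    and diag: "\<And>a. 0 \<le> a \<Longrightarrow> a < T \<Longrightarrow> \<Xi> a a = 0"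
    and defect: "\<And>a c b. 0 \<le> a \<Longrightarrow> a \<le> c \<Longrightarrow> c \<le> b \<Longrightarrow> b < T \<Longrightarrow>
      N (\<Xi> a b - \<Xi> a c - \<Xi> c b) \<le> K * (b - a) powr \<theta>"
  obtains Z C where "\<And>t. 0 \<le> t \<Longrightarrow> t < T \<Longrightarrow> Z t \<in> V"
    and "\<And>a b. 0 \<le> a \<Longrightarrow> a \<le> b \<Longrightarrow> b < T \<Longrightarrow> N (Z b - Z a - \<Xi> a b) \<le> C * (b - a) powr \<theta>"
proof -
  define g where "g = (\<lambda>m j. T * real j / 2 ^ m)"
  define S where "S = (\<lambda>m t. \<Sum>j<2 ^ m. \<Xi> (min t (g m j)) (min t (g m (Suc j))))"
  define e where "e = (\<lambda>m::nat. 2 ^ m * (K * (T / 2 ^ m) powr \<theta>))"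
  have g_mono: "g m i \<le> g m j" if "i \<le> j" for m i j
    using that T unfolding g_def by (intro divide_right_mono mult_left_mono) auto
  have g_nonneg: "0 \<le> g m j" for m j
    using T by (simp add: g_def)
  have g_step: "g m (Suc j) - g m j = T / 2 ^ m" for m j
    by (simp add: g_def field_simps)
  have g_even: "g (Suc m) (2 * j) = g m j" for m j
    by (simp add: g_def field_simps)
  have cell: "N (\<Xi> u w - \<Xi> u v - \<Xi> v w) \<le> K * (T / 2 ^ m) powr \<theta>"
    if "0 \<le> u" "u \<le> v" "v \<le> w" "w < T" "w - u \<le> T / 2 ^ m" for u v w m
  proof -
    have "N (\<Xi> u w - \<Xi> u v - \<Xi> v w) \<le> K * (w - u) powr \<theta>"
      using that by (intro defect)
    also have "\<dots> \<le> K * (T / 2 ^ m) powr \<theta>"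
      using that K \<theta> by (intro mult_left_mono powr_mono2) auto
    finally show ?thesis .
  qed
  have memcell: "\<Xi> (min t (g m i)) (min t (g m j)) \<in> V" if "0 \<le> t" "t < T" "i \<le> j" for m t i j
    using that g_mono [OF that(3), of m] g_nonneg by (intro mem) auto
  have memS: "S m t \<in> V" if "0 \<le> t" "t < T" for m t
    unfolding S_def using that by (intro sum_mem memcell) auto
  have e_eq: "e m = K * T powr \<theta> * (2 / 2 powr \<theta>) ^ m" for m
  proof -
    have "(2 ^ m) powr \<theta> = (2 powr \<theta>) ^ m"
      by (simp add: powr_realpow [symmetric] powr_powr powr_powr_swap mult.commute)
    then show ?thesis
      using T by (simp add: e_def powr_divide field_simps)
  qed
  have ratio: "norm (2 / 2 powr \<theta>) < 1"
    using \<theta> powr_less_mono [of 1 \<theta> 2] by simp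
  have summable_e: "summable e"
    unfolding e_eq [abs_def] by (intro summable_mult summable_geometric ratio)
  have step: "N (S (Suc m) t - S m t) \<le> e m" if t: "0 \<le> t" "t < T" for m t
  proof -
    let ?h = "\<lambda>j. min t (g (Suc m) j)"
    let ?d = "\<lambda>j. \<Xi> (?h (2*j)) (?h (Suc (2*j))) + \<Xi> (?h (Suc (2*j))) (?h (Suc (Suc (2*j))))
      - \<Xi> (?h (2*j)) (?h (Suc (Suc (2*j))))"
    have g2: "g (Suc m) (Suc (Suc (2 * j))) = g m (Suc j)" for j
      using g_even [of m "Suc j"] by simp
    have memd: "?d j \<in> V" for j
      using t by (intro diff_mem add_mem memcell) auto
    have diff: "S (Suc m) t - S m t = (\<Sum>j<2 ^ m. ?d j)"
      unfolding S_def power_Suc sum_even_odd by (simp add: sum_subtractf g_even g2)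
    have "N (\<Sum>j<2 ^ m. ?d j) \<le> (\<Sum>j<(2::nat) ^ m. K * (T / 2 ^ m) powr \<theta>)"
    proof (rule norm_sum_le)
      fix j
      have h: "?h (2*j) \<le> ?h (Suc (2*j))" "?h (Suc (2*j)) \<le> ?h (Suc (Suc (2*j)))"
        using g_mono [of "2*j" "Suc (2*j)" "Suc m"] g_mono [of "Suc (2*j)" "Suc (Suc (2*j))" "Suc m"]
        by auto
      have "N (?d j) = N (- ?d j)"
        using memd by (simp only: norm_neg)
      also have "- ?d j = \<Xi> (?h (2*j)) (?h (Suc (Suc (2*j)))) - \<Xi> (?h (2*j)) (?h (Suc (2*j)))
          - \<Xi> (?h (Suc (2*j))) (?h (Suc (Suc (2*j))))"
        by simp
      also have "N \<dots> \<le> K * (T / 2 ^ m) powr \<theta>"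
      proof (rule cell)
        show "?h (Suc (Suc (2*j))) - ?h (2*j) \<le> T / 2 ^ m"
          using g_step [of m j] g_mono [of j "Suc j" m] unfolding g2 g_even by (auto simp: min_def)
      qed (use t h g_nonneg in auto)
      finally show "N (?d j) \<le> K * (T / 2 ^ m) powr \<theta>" .
    qed (rule memd)
    then show ?thesis
      unfolding diff e_def by simp
  qed
  have "\<exists>v. v \<in> V \<and> (\<lambda>m. N (S m t - v)) \<longlonglongrightarrow> 0" if "0 \<le> t" "t < T" for t
    using summable_steps_converge [OF memS [OF that] step [OF that] summable_e] by blast
  then obtain Z where Z: "\<And>t. 0 \<le> t \<Longrightarrow> t < T \<Longrightarrow> Z t \<in> V"
    "\<And>t. 0 \<le> t \<Longrightarrow> t < T \<Longrightarrow> (\<lambda>m. N (S m t - Z t)) \<longlonglongrightarrow> 0"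
    by metis
  define C where "C = 2 * K * 2 powr \<theta> / (2 powr \<theta> - 2)"
  have close: "N (Z b - Z a - \<Xi> a b) \<le> C * (b - a) powr \<theta>" if ab: "0 \<le> a" "a \<le> b" "b < T" for a b
  proof -
    have a: "a < T" and b: "0 \<le> b" using ab by auto
    define x where "x = (\<lambda>m j. max a (min b (g m j)))"
    define P where "P = (\<lambda>m. \<Sum>j<2 ^ m. \<Xi> (x m j) (x m (Suc j)))"
    have x_mono: "mono (x m)" for m
      unfolding x_def by (intro monoI max.mono min.mono g_mono order.refl)
    have x_range: "0 \<le> x m j" "x m j < T" for m j
      using ab by (auto simp: x_def)
    have x_ends: "x m 0 = a" "x m (2 ^ m) = b" for m
      using ab T by (auto simp: x_def g_def)
    have memx: "\<Xi> (x m j) (x m (Suc j)) \<in> V" for m j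
      using x_range monoD [OF x_mono, of j "Suc j" m] by (intro mem) auto
    have memP: "P m \<in> V" for m
      unfolding P_def by (intro sum_mem memx)
    have P: "N (P m - \<Xi> a b) \<le> C * (b - a) powr \<theta>" for m
      using partition_bound [OF \<theta> K mem diag defect x_mono [of m] x_range, of 0 "2 ^ m"]
      unfolding P_def C_def x_ends by (simp add: lessThan_atLeast0)
    \<comment> \<open>The three sums cancel cell by cell, except for one defect on a cell that \<open>a\<close> splits.\<close>
    have SP: "N (S m b - S m a - P m) \<le> e m" for m
    proof -
      let ?d = "\<lambda>j. \<Xi> (min b (g m j)) (min b (g m (Suc j)))
        - \<Xi> (min a (g m j)) (min a (g m (Suc j))) - \<Xi> (x m j) (x m (Suc j))"
      have diff: "S m b - S m a - P m = (\<Sum>j<2 ^ m. ?d j)"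
        unfolding S_def P_def by (simp add: sum_subtractf)
      have "N (\<Sum>j<2 ^ m. ?d j) \<le> (\<Sum>j<(2::nat) ^ m. K * (T / 2 ^ m) powr \<theta>)"
      proof (rule norm_sum_le)
        fix j
        show "?d j \<in> V"
          using ab a b by (intro diff_mem memcell memx) auto
        have gj: "g m j \<le> g m (Suc j)" "0 \<le> g m j"
          by (auto intro: g_mono g_nonneg)
        consider "g m (Suc j) \<le> a" | "a \<le> g m j" | "g m j \<le> a" "a \<le> g m (Suc j)"
          using gj by linarith
        then show "N (?d j) \<le> K * (T / 2 ^ m) powr \<theta>"
        proof cases
          case 1
          then have "min b (g m j) = g m j" "min b (g m (Suc j)) = g m (Suc j)"
            "min a (g m j) = g m j" "min a (g m (Suc j)) = g m (Suc j)" "x m j = a" "x m (Suc j) = a"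
            using gj ab by (auto simp: x_def)
          then have "?d j = 0"
            using ab a diag by simp
          then show ?thesis using K by simp
        next
          case 2
          then have "min a (g m j) = a" "min a (g m (Suc j)) = a"
            "x m j = min b (g m j)" "x m (Suc j) = min b (g m (Suc j))"
            using gj ab by (auto simp: x_def)
          then have "?d j = 0"
            using ab a diag by simp
          then show ?thesis using K by simp
        next
          case 3
          then have "min b (g m j) = g m j" "min a (g m j) = g m j" "min a (g m (Suc j)) = a"
            "x m j = a" "x m (Suc j) = min b (g m (Suc j))"
            using gj ab by (auto simp: x_def)
          then have "?d j = \<Xi> (g m j) (min b (g m (Suc j))) - \<Xi> (g m j) a - \<Xi> a (min b (g m (Suc j)))"
            by simp
          also have "N \<dots> \<le> K * (T / 2 ^ m) powr \<theta>"
            using 3 gj ab g_step [of m j] by (intro cell) (auto simp: min_def)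
          finally show ?thesis .
        qed
      qed
      then show ?thesis
        unfolding diff e_def by simp
    qed
    have bound: "N (Z b - Z a - \<Xi> a b)
        \<le> N (S m b - Z b) + N (S m a - Z a) + e m + C * (b - a) powr \<theta>" for m
    proof -
      have mems: "S m b - Z b \<in> V" "S m a - Z a \<in> V" "S m b - S m a - P m \<in> V" "P m - \<Xi> a b \<in> V"
        using ab a b memS memP mem Z(1) by (auto intro!: diff_mem)
      have "Z b - Z a - \<Xi> a b
          = ((S m b - S m a - P m) + (P m - \<Xi> a b)) - ((S m b - Z b) - (S m a - Z a))"
        by simp
      also have "N \<dots> \<le> N ((S m b - S m a - P m) + (P m - \<Xi> a b)) + N ((S m b - Z b) - (S m a - Z a))"
        by (intro norm_diff_le add_mem diff_mem mems)
      also have "\<dots> \<le> (N (S m b - S m a - P m) + N (P m - \<Xi> a b)) + (N (S m b - Z b) + N (S m a - Z a))"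
        by (intro add_mono norm_triangle norm_diff_le mems)
      finally show ?thesis
        using SP [of m] P [of m] by linarith
    qed
    have "(\<lambda>m. N (S m b - Z b) + N (S m a - Z a) + e m + C * (b - a) powr \<theta>)
        \<longlonglongrightarrow> 0 + 0 + 0 + C * (b - a) powr \<theta>"
      using ab a b by (intro tendsto_intros Z(2) summable_LIMSEQ_zero summable_e)
    then have "(\<lambda>m. N (S m b - Z b) + N (S m a - Z a) + e m + C * (b - a) powr \<theta>)
        \<longlonglongrightarrow> C * (b - a) powr \<theta>"
      by simp
    then show ?thesis
      by (rule LIMSEQ_le_const) (use bound in auto)
  qed
  show ?thesis
    using that [of Z C, OF Z(1) close] .
qed

end

section \<open>The product of the completed tensor powers\<close>

context completed_tensor_powers
begin

sublocale level: banach_subspace "V k" "N k" for k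
  using completion [of k] by unfold_locales (simp add: is_completion_def)

abbreviation unit where "unit \<equiv> \<iota> 0 (pure_tensor [])"

lemma pure_mem: "length es = k \<Longrightarrow> pure_tensor es \<in> tensor_power k"
  unfolding tensor_power_def by (rule span_base) auto

lemma
  shows embed_mem: "s \<in> tensor_power k \<Longrightarrow> \<iota> k s \<in> V k"
    and embed_add: "s \<in> tensor_power k \<Longrightarrow> t \<in> tensor_power k \<Longrightarrow> \<iota> k (s + t) = \<iota> k s + \<iota> k t"
    and embed_scale: "s \<in> tensor_power k \<Longrightarrow> \<iota> k (c *\<^sub>R s) = c *\<^sub>R \<iota> k s"
    and embed_dense: "v \<in> V k \<Longrightarrow> 0 < e \<Longrightarrow> \<exists>s\<in>tensor_power k. N k (v - \<iota> k s) < e"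
  using completion [of k] unfolding is_completion_def by blast+

lemma unit_mem [simp]: "unit \<in> V 0"
  by (intro embed_mem pure_mem) simp

text \<open>Identities between bounded linear maps extend from pure tensors to the completion: first to the
  algebraic tensor power by linearity, then to its closure. It is applied to differences of the two
  sides of the unit and associativity laws, one variable at a time.\<close>
lemma zero_on_pure_tensors:
  assumes mem: "\<And>u. u \<in> V k \<Longrightarrow> F u \<in> V m"
    and add: "\<And>u v. u \<in> V k \<Longrightarrow> v \<in> V k \<Longrightarrow> F (u + v) = F u + F v"
    and scale: "\<And>c u. u \<in> V k \<Longrightarrow> F (c *\<^sub>R u) = c *\<^sub>R F u"
    and bound: "\<And>u. u \<in> V k \<Longrightarrow> N m (F u) \<le> C * N k u"
    and pure: "\<And>es. length es = k \<Longrightarrow> F (\<iota> k (pure_tensor es)) = 0"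
    and u: "u \<in> V k"
  shows "F u = 0"
proof -
  have zero: "F (\<iota> k s) = 0" if "s \<in> tensor_power k" for s
  proof -
    have "s \<in> span {pure_tensor es | es. length es = k}"
      using that by (simp add: tensor_power_def)
    then have "s \<in> tensor_power k \<and> F (\<iota> k s) = 0"
    proof (induction rule: span_induct_alt)
      case base
      have "\<iota> k 0 = 0"
        using embed_scale [of "0" k 0] by (simp add: tensor_power_def span_zero)
      moreover have "F 0 = 0"
        using scale [of 0 0] by simp
      ultimately show ?case
        by (simp add: tensor_power_def span_zero)
    next
      case (step c x y)
      then obtain es where es: "x = pure_tensor es" "length es = k"
        by blast
      have x: "x \<in> tensor_power k" "c *\<^sub>R x \<in> tensor_power k"
        using pure_mem [OF es(2)] es unfolding tensor_power_def by (simp_all only: span_scale)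
      then show ?case
        using step es pure [OF es(2)]
        by (simp add: embed_add embed_scale add scale embed_mem tensor_power_def span_add)
    qed
    then show ?thesis by simp
  qed
  have small: "N m (F u) \<le> 0 + e" if "0 < e" for e
  proof -
    from that obtain s where s: "s \<in> tensor_power k" "N k (u - \<iota> k s) < e / (\<bar>C\<bar> + 1)"
      using embed_dense [OF u, of "e / (\<bar>C\<bar> + 1)"] by auto
    have mems: "u - \<iota> k s \<in> V k" "\<iota> k s \<in> V k"
      using u s by (simp_all add: embed_mem)
    have "F u = F ((u - \<iota> k s) + \<iota> k s)"
      by simp
    also have "\<dots> = F (u - \<iota> k s)"
      using add [OF mems] zero s by simp
    finally have "N m (F u) \<le> C * N k (u - \<iota> k s)"
      using bound mems by simp
    also have "\<dots> \<le> (\<bar>C\<bar> + 1) * (e / (\<bar>C\<bar> + 1))"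
      using s level.norm_nonneg [OF mems(1)] that by (intro mult_mono) auto
    also have "\<dots> = 0 + e"
      by simp
    finally show ?thesis .
  qed
  have "N m (F u) \<le> 0"
    using small by (rule field_le_epsilon)
  then have "N m (F u) = 0"
    using level.norm_nonneg [OF mem [OF u]] by linarith
  then show ?thesis
    using level.norm_eq_0_iff [OF mem [OF u]] by simp
qed

lemma tens_zero_left: "v \<in> V m \<Longrightarrow> tens k m 0 v = 0"
  using tens_scale_left [of 0 k v m 0] by simp

lemma tens_zero_right: "u \<in> V k \<Longrightarrow> tens k m u 0 = 0"
  using tens_scale_right [of u k 0 m 0] by simp

lemma tens_sum_left:
  "(\<And>i. i \<in> A \<Longrightarrow> f i \<in> V k) \<Longrightarrow> v \<in> V m \<Longrightarrow> tens k m (sum f A) v = (\<Sum>i\<in>A. tens k m (f i) v)"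
  by (induction A rule: infinite_finite_induct) (auto simp: tens_zero_left tens_add_left level.sum_mem)

lemma tens_sum_right:
  "u \<in> V k \<Longrightarrow> (\<And>i. i \<in> A \<Longrightarrow> f i \<in> V m) \<Longrightarrow> tens k m u (sum f A) = (\<Sum>i\<in>A. tens k m u (f i))"
  by (induction A rule: infinite_finite_induct) (auto simp: tens_zero_right tens_add_right level.sum_mem)

lemma tens_mem: "u \<in> V i \<Longrightarrow> v \<in> V j \<Longrightarrow> i + j = k \<Longrightarrow> tens i j u v \<in> V k"
  using tens_closed by blast

lemma tens_norm_mono:
  assumes "u \<in> V i" "v \<in> V j" "i + j = k" "N i u \<le> x" "N j v \<le> y"
  shows "N k (tens i j u v) \<le> x * y"
proof -
  have "N k (tens i j u v) \<le> N i u * N j v"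
    using assms tens_norm by blast
  also have "\<dots> \<le> x * y"
    using assms level.norm_nonneg by (intro mult_mono) (auto intro: order_trans)
  finally show ?thesis .
qed

lemma tens_unit_right:
  assumes "u \<in> V k" shows "tens k 0 u unit = u"
proof -
  have "tens k 0 u unit - u = 0"
  proof (rule zero_on_pure_tensors [where F = "\<lambda>u. tens k 0 u unit - u" and k = k and m = k
        and C = "N 0 unit + 1"])
    fix u assume u: "u \<in> V k"
    have mem: "tens k 0 u unit \<in> V k" using u by (intro tens_mem) auto
    then show "tens k 0 u unit - u \<in> V k" using u by simp
    have "N k (tens k 0 u unit - u) \<le> N k (tens k 0 u unit) + N k u"
      using mem u by (rule level.norm_diff_le)
    also have "\<dots> \<le> (N 0 unit + 1) * N k u"
      using tens_norm [OF u unit_mem] by (simp add: algebra_simps)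
    finally show "N k (tens k 0 u unit - u) \<le> (N 0 unit + 1) * N k u" .
  qed (use assms tens_pure [of _ k "[]" 0] in
      \<open>auto simp: tens_add_left tens_scale_left scaleR_diff_right\<close>)
  then show ?thesis by simp
qed

lemma tens_unit_left:
  assumes "u \<in> V k" shows "tens 0 k unit u = u"
proof -
  have "tens 0 k unit u - u = 0"
  proof (rule zero_on_pure_tensors [where F = "\<lambda>u. tens 0 k unit u - u" and k = k and m = k
        and C = "N 0 unit + 1"])
    fix u assume u: "u \<in> V k"
    have mem: "tens 0 k unit u \<in> V k" using u by (intro tens_mem) auto
    then show "tens 0 k unit u - u \<in> V k" using u by simp
    have "N k (tens 0 k unit u - u) \<le> N k (tens 0 k unit u) + N k u"
      using mem u by (rule level.norm_diff_le)
    also have "\<dots> \<le> (N 0 unit + 1) * N k u"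
      using tens_norm [OF unit_mem u] by (simp add: algebra_simps)
    finally show "N k (tens 0 k unit u - u) \<le> (N 0 unit + 1) * N k u" .
  qed (use assms tens_pure [of "[]" 0 _ k] in
      \<open>auto simp: tens_add_right tens_scale_right scaleR_diff_right\<close>)
  then show ?thesis by simp
qed

lemma tens_assoc:
  assumes u: "u \<in> V i" and v: "v \<in> V j" and w: "w \<in> V l"
  shows "tens (i + j) l (tens i j u v) w = tens i (j + l) u (tens j l v w)"
proof -
  let ?A = "\<lambda>u v w. tens (i + j) l (tens i j u v) w - tens i (j + l) u (tens j l v w)"
  have mem: "?A u v w \<in> V (i + j + l)" if "u \<in> V i" "v \<in> V j" "w \<in> V l" for u v w
    using that by (intro level.diff_mem tens_mem tens_closed) auto
  have bound: "N (i + j + l) (?A u v w) \<le> 2 * (N i u * N j v * N l w)"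
    if "u \<in> V i" "v \<in> V j" "w \<in> V l" for u v w
  proof -
    have "N (i + j + l) (?A u v w) \<le> N (i + j + l) (tens (i + j) l (tens i j u v) w)
        + N (i + j + l) (tens i (j + l) u (tens j l v w))"
      using that by (intro level.norm_diff_le tens_mem tens_closed) auto
    also have "\<dots> \<le> N i u * N j v * N l w + N i u * (N j v * N l w)"
      using that by (intro add_mono tens_norm_mono tens_closed tens_norm) auto
    finally show ?thesis by (simp add: mult.assoc)
  qed
  note linear = tens_add_left tens_add_right tens_scale_left tens_scale_right tens_closed
    scaleR_diff_right
  have pure_V: "\<iota> (length es) (pure_tensor es) \<in> V (length es)" for es
    by (intro embed_mem pure_mem) simp
  have ppp: "?A (\<iota> i (pure_tensor es)) (\<iota> j (pure_tensor fs)) (\<iota> l (pure_tensor gs)) = 0"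
    if "length es = i" "length fs = j" "length gs = l" for es fs gs
    using that by (simp add: tens_pure add.assoc)
  have ppw: "?A (\<iota> i (pure_tensor es)) (\<iota> j (pure_tensor fs)) w = 0"
    if es: "length es = i" and fs: "length fs = j" and w: "w \<in> V l" for es fs w
    by (rule zero_on_pure_tensors [where F = "\<lambda>w. ?A (\<iota> i (pure_tensor es)) (\<iota> j (pure_tensor fs)) w"
          and k = l and m = "i + j + l"
          and C = "2 * (N i (\<iota> i (pure_tensor es)) * N j (\<iota> j (pure_tensor fs)))"])
      (use es fs w pure_V [of es] pure_V [of fs] mem bound ppp in \<open>auto simp: linear mult.assoc\<close>)
  have pvw: "?A (\<iota> i (pure_tensor es)) v w = 0"
    if es: "length es = i" and v: "v \<in> V j" and w: "w \<in> V l" for es v w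
    by (rule zero_on_pure_tensors [where F = "\<lambda>v. ?A (\<iota> i (pure_tensor es)) v w"
          and k = j and m = "i + j + l" and C = "2 * (N i (\<iota> i (pure_tensor es)) * N l w)"])
      (use es v w pure_V [of es] mem bound ppw in \<open>auto simp: linear mult_ac\<close>)
  have "?A u v w = 0"
    by (rule zero_on_pure_tensors [where F = "\<lambda>u. ?A u v w"
          and k = i and m = "i + j + l" and C = "2 * (N j v * N l w)"])
      (use u v w mem bound pvw in \<open>auto simp: linear mult_ac\<close>)
  then show ?thesis by simp
qed

text \<open>The Cauchy product on sequences of tensors, i.e. the product of the completed tensor algebra
  without any summability. In these terms the Chen relation reads \<open>Y\<^sub>a\<^sub>b = Y\<^sub>a\<^sub>c \<otimes> Y\<^sub>c\<^sub>b\<close>.\<close>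
definition gprod :: "(nat \<Rightarrow> 'v) \<Rightarrow> (nat \<Rightarrow> 'v) \<Rightarrow> nat \<Rightarrow> 'v"
  where "gprod u v k = (\<Sum>i=0..k. tens i (k - i) (u i) (v (k - i)))"

lemma gprod_assoc:
  assumes u: "\<And>i. u i \<in> V i" and v: "\<And>i. v i \<in> V i" and w: "\<And>i. w i \<in> V i"
  shows "gprod (gprod u v) w k = gprod u (gprod v w) k"
proof -
  let ?f = "\<lambda>i j l. tens i (j + l) (u i) (tens j l (v j) (w l))"
  have "gprod (gprod u v) w k = (\<Sum>j=0..k. \<Sum>i=0..j. ?f i (j - i) (k - j))"
    unfolding gprod_def
  proof (intro sum.cong refl)
    fix j assume j: "j \<in> {0..k}"
    have "tens j (k - j) (\<Sum>i=0..j. tens i (j - i) (u i) (v (j - i))) (w (k - j))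
        = (\<Sum>i=0..j. tens j (k - j) (tens i (j - i) (u i) (v (j - i))) (w (k - j)))"
      using u v w by (intro tens_sum_left tens_mem) auto
    also have "\<dots> = (\<Sum>i=0..j. ?f i (j - i) (k - j))"
    proof (intro sum.cong refl)
      fix i assume "i \<in> {0..j}"
      then show "tens j (k - j) (tens i (j - i) (u i) (v (j - i))) (w (k - j)) = ?f i (j - i) (k - j)"
        using tens_assoc [OF u [of i] v [of "j - i"] w [of "k - j"]] by simp
    qed
    finally show "tens j (k - j) (\<Sum>i=0..j. tens i (j - i) (u i) (v (j - i))) (w (k - j))
        = (\<Sum>i=0..j. ?f i (j - i) (k - j))" .
  qed
  also have "\<dots> = (\<Sum>j=0..k. \<Sum>i=0..k - j. ?f j i (k - j - i))"
    by (rule fps_mult_assoc_lemma)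
  also have "\<dots> = gprod u (gprod v w) k"
    unfolding gprod_def
  proof (intro sum.cong refl)
    fix j assume j: "j \<in> {0..k}"
    have "(\<Sum>i=0..k - j. ?f j i (k - j - i))
        = (\<Sum>i=0..k - j. tens j (k - j) (u j) (tens i (k - j - i) (v i) (w (k - j - i))))"
    proof (intro sum.cong refl)
      fix i assume "i \<in> {0..k - j}"
      then have "i + (k - j - i) = k - j"
        by simp
      then show "?f j i (k - j - i) = tens j (k - j) (u j) (tens i (k - j - i) (v i) (w (k - j - i)))"
        by (simp only:)
    qed
    also have "\<dots> = tens j (k - j) (u j) (\<Sum>i=0..k - j. tens i (k - j - i) (v i) (w (k - j - i)))"
      using u v w by (intro tens_sum_right [symmetric] tens_mem) auto
    finally show "(\<Sum>i=0..k - j. ?f j i (k - j - i))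
      = tens j (k - j) (u j) (\<Sum>i=0..k - j. tens i (k - j - i) (v i) (w (k - j - i)))" .
  qed
  finally show ?thesis .
qed

definition mixed :: "nat \<Rightarrow> (nat \<Rightarrow> 'v) \<Rightarrow> (nat \<Rightarrow> 'v) \<Rightarrow> 'v"
  where "mixed k u v = (\<Sum>i=1..<k. tens i (k - i) (u i) (v (k - i)))"

lemma mixed_mem: "(\<And>i. i < k \<Longrightarrow> u i \<in> V i) \<Longrightarrow> (\<And>i. i < k \<Longrightarrow> v i \<in> V i) \<Longrightarrow> mixed k u v \<in> V k"
  unfolding mixed_def by (intro level.sum_mem tens_mem) auto

lemma gprod_eq_mixed:
  assumes "0 < k"
  shows "gprod u v k = tens 0 k (u 0) (v k) + tens k 0 (u k) (v 0) + mixed k u v"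
proof -
  have "{0..k} = insert 0 (insert k {1..<k})"
    using assms by auto
  then show ?thesis
    using assms by (simp add: gprod_def mixed_def add.assoc)
qed

lemma gprod_unit_eq:
  assumes "0 < k" "u 0 = unit" "v 0 = unit" "u k \<in> V k" "v k \<in> V k"
  shows "gprod u v k = u k + v k + mixed k u v"
  using assms by (simp add: gprod_eq_mixed tens_unit_left tens_unit_right add_ac)

lemma mixed_cong:
  "(\<And>i. 0 < i \<Longrightarrow> i < k \<Longrightarrow> u i = u' i) \<Longrightarrow> (\<And>i. 0 < i \<Longrightarrow> i < k \<Longrightarrow> v i = v' i) \<Longrightarrow>
    mixed k u v = mixed k u' v'"
  unfolding mixed_def by (intro sum.cong) auto

text \<open>This is associativity read at level \<open>k\<close>. The level-\<open>k\<close> components are unknown, so they are set to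
  \<open>0\<close>: then \<open>u \<otimes> v\<close> agrees with \<open>uv\<close> below \<open>k\<close> and has \<open>mixed k u v\<close> at level \<open>k\<close>, and comparing both
  bracketings of \<open>u \<otimes> v \<otimes> w\<close> gives the identity.\<close>
lemma mixed_cocycle:
  assumes k: "0 < k"
    and units: "u 0 = unit" "v 0 = unit" "w 0 = unit" "uv 0 = unit" "vw 0 = unit"
    and mem: "\<And>i. i < k \<Longrightarrow> u i \<in> V i" "\<And>i. i < k \<Longrightarrow> v i \<in> V i" "\<And>i. i < k \<Longrightarrow> w i \<in> V i"
    and uv: "\<And>i. i < k \<Longrightarrow> uv i = gprod u v i"
    and vw: "\<And>i. i < k \<Longrightarrow> vw i = gprod v w i"
  shows "mixed k u v + mixed k uv w = mixed k u vw + mixed k v w"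
proof -
  define trunc where "trunc = (\<lambda>(x :: nat \<Rightarrow> 'v) i. if i < k then x i else 0)"
  let ?u = "trunc u" and ?v = "trunc v" and ?w = "trunc w"
  have mems: "?u i \<in> V i" "?v i \<in> V i" "?w i \<in> V i" for i
    using mem by (auto simp: trunc_def)
  have trunc0: "?u 0 = unit" "?v 0 = unit" "?w 0 = unit" "?u k = 0" "?v k = 0" "?w k = 0"
    using k units by (auto simp: trunc_def)
  have lower: "gprod (trunc x) (trunc y) i = gprod x y i" if "i < k" for x y i
    using that unfolding gprod_def by (intro sum.cong) (auto simp: trunc_def)
  have mixed_trunc: "mixed k (trunc x) (trunc y) = mixed k x y" for x y
    by (rule mixed_cong) (auto simp: trunc_def)
  have top: "gprod ?u ?v k = mixed k u v" "gprod ?v ?w k = mixed k v w"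
    using k trunc0 mems by (simp_all add: gprod_unit_eq mixed_trunc)
  have memi: "mixed k u v \<in> V k" "mixed k v w \<in> V k"
    using mem by (auto intro: mixed_mem)
  have unit_prod: "gprod ?u ?v 0 = unit" "gprod ?v ?w 0 = unit"
    using uv [of 0] vw [of 0] units k by (simp_all add: lower)
  have "gprod (gprod ?u ?v) ?w k = mixed k u v + mixed k (gprod ?u ?v) ?w"
    using k trunc0 unit_prod top memi by (simp add: gprod_unit_eq)
  also have "mixed k (gprod ?u ?v) ?w = mixed k uv w"
    by (rule mixed_cong) (auto simp: lower uv, auto simp: trunc_def)
  finally have left: "gprod (gprod ?u ?v) ?w k = mixed k u v + mixed k uv w" .
  have "gprod ?u (gprod ?v ?w) k = mixed k v w + mixed k ?u (gprod ?v ?w)"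
    using k trunc0 unit_prod top memi by (simp add: gprod_unit_eq)
  also have "mixed k ?u (gprod ?v ?w) = mixed k u vw"
    by (rule mixed_cong) (auto simp: lower vw, auto simp: trunc_def)
  finally have right: "gprod ?u (gprod ?v ?w) k = mixed k v w + mixed k u vw" .
  show ?thesis
    using gprod_assoc [of ?u ?v ?w k, OF mems] left right by (simp add: add.commute)
qed

end

section \<open>Constants with factorial decay\<close>

text \<open>The choice is \<open>c k = \<beta> * B ^ k / (fact k) powr (\<alpha> / 2)\<close>. The exponent \<open>\<alpha> / 2\<close> instead of \<open>\<alpha>\<close> avoids the
  neo-classical inequality of Lyons: with \<open>k choose i \<le> 2 ^ k\<close> the convolution of \<open>c\<close> with itself is at
  most \<open>c k * \<beta> * k * 2 powr (k * \<alpha> / 2)\<close>, which a small \<open>\<beta>\<close> makes smaller than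
  \<open>c k * (2 powr (k * \<alpha>) - 2)\<close>. A large \<open>B\<close> then accommodates the given bound \<open>M\<close>.\<close>
lemma extension_constants:
  fixes \<alpha> M :: real
  assumes \<alpha>: "0 < \<alpha>" and large: "1 < real (n + 1) * \<alpha>"
  obtains c :: "nat \<Rightarrow> real" where "\<And>k. 0 \<le> c k"
    and "\<And>k. 0 < k \<Longrightarrow> k \<le> n \<Longrightarrow> M \<le> c k"
    and "\<And>k. n < k \<Longrightarrow> (\<Sum>i=1..<k. c i * c (k - i)) / (2 powr (real k * \<alpha>) - 2) \<le> c k"
    and "\<And>x. 0 \<le> x \<Longrightarrow> summable (\<lambda>k. c k * x ^ k)"
proof -
  define \<gamma> where "\<gamma> = \<alpha> / 2"
  \<comment> \<open>The quotient of \<open>k * 2 powr (k * \<gamma>)\<close> by \<open>2 powr (k * \<alpha>) - 2\<close>, written in powers of \<open>z\<close>, tends to \<open>0\<close> and is therefore bounded.\<close>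
  define z :: real where "z = 2 powr - \<gamma>"
  have \<gamma>: "0 < \<gamma>" using \<alpha> by (simp add: \<gamma>_def)
  have z: "0 < z" "z < 1"
    using \<gamma> powr_less_mono [of "- \<gamma>" 0 2] by (auto simp: z_def)
  have zk: "z ^ k = 2 powr (- (real k * \<gamma>))" for k
    by (simp add: z_def powr_realpow [symmetric] powr_powr mult.commute)
  have "(\<lambda>k. real k * z ^ k / (1 - 2 * (z ^ k * z ^ k))) \<longlonglongrightarrow> 0 / (1 - 2 * (0 * 0))"
    using z by (intro tendsto_intros powser_times_n_limit_0 LIMSEQ_realpow_zero) auto
  then have "Bseq (\<lambda>k. real k * z ^ k / (1 - 2 * (z ^ k * z ^ k)))"
    by (intro convergent_imp_Bseq) (auto simp: convergent_def)
  then obtain D where D: "0 < D" "\<And>k. \<bar>real k * z ^ k / (1 - 2 * (z ^ k * z ^ k))\<bar> \<le> D"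
    by (auto simp: Bseq_def)
  define \<beta> where "\<beta> = 1 / D"
  have \<beta>: "0 < \<beta>" using D by (simp add: \<beta>_def)
  have gap: "\<beta> * real k * 2 powr (real k * \<gamma>) \<le> 2 powr (real k * \<alpha>) - 2"
    and gap_pos: "2 < 2 powr (real k * \<alpha>)" if "n < k" for k
  proof -
    have "real (n + 1) * \<alpha> \<le> real k * \<alpha>"
      using that \<alpha> by (intro mult_right_mono) auto
    then have "1 < real k * \<alpha>"
      using large by linarith
    then show "2 < 2 powr (real k * \<alpha>)"
      using powr_less_mono [of 1 "real k * \<alpha>" 2] by simp
    define w where "w = 2 powr (real k * \<gamma>)"
    have ww: "2 powr (real k * \<alpha>) = w * w"
      by (simp add: w_def \<gamma>_def powr_add [symmetric] field_simps)
    have w: "0 < w" "z ^ k = 1 / w"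
      by (auto simp: w_def zk powr_minus divide_inverse)
    have two: "2 < w * w"
      using \<open>2 < 2 powr (real k * \<alpha>)\<close> ww by simp
    have "real k * z ^ k / (1 - 2 * (z ^ k * z ^ k)) = real k * w / (w * w - 2)"
      unfolding w(2) using w(1) two by (simp add: field_simps)
    then have "real k * w / (w * w - 2) \<le> D"
      using abs_le_D1 [OF D(2) [of k]] by simp
    then have "real k * w \<le> D * (w * w - 2)"
      using two by (simp add: pos_divide_le_eq)
    then have "\<beta> * real k * w \<le> w * w - 2"
      using D(1) by (simp add: \<beta>_def field_simps)
    then show "\<beta> * real k * 2 powr (real k * \<gamma>) \<le> 2 powr (real k * \<alpha>) - 2"
      unfolding ww by (simp add: w_def)
  qed
  define B where "B = max 1 (M * fact n powr \<gamma> / \<beta>)"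
  define c where "c = (\<lambda>k. \<beta> * B ^ k / fact k powr \<gamma>)"
  have B: "1 \<le> B" "M * fact n powr \<gamma> / \<beta> \<le> B"
    by (auto simp: B_def)
  show ?thesis
  proof (rule that [of c])
    show c0: "0 \<le> c k" for k
      using \<beta> B by (simp add: c_def)
    show "M \<le> c k" if "0 < k" "k \<le> n" for k
    proof -
      have "M * fact k powr \<gamma> \<le> \<beta> * B ^ k"
      proof (cases "0 \<le> M")
        case True
        have "M * fact k powr \<gamma> \<le> M * fact n powr \<gamma>"
          using True \<gamma> that by (intro mult_left_mono powr_mono2 fact_mono) auto
        also have "\<dots> \<le> \<beta> * B"
          using B(2) \<beta> by (simp add: field_simps)
        also have "\<dots> \<le> \<beta> * B ^ k"
          using \<beta> B(1) that by (intro mult_left_mono self_le_power) auto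
        finally show ?thesis .
      next
        case False
        then have "M * fact k powr \<gamma> \<le> 0"
          by (simp add: mult_nonpos_nonneg)
        also have "0 \<le> \<beta> * B ^ k" using \<beta> B(1) by simp
        finally show ?thesis .
      qed
      then show ?thesis
        by (simp add: c_def pos_le_divide_eq)
    qed
    show "(\<Sum>i=1..<k. c i * c (k - i)) / (2 powr (real k * \<alpha>) - 2) \<le> c k" if "n < k" for k
    proof -
      have term_le: "c i * c (k - i) \<le> c k * (\<beta> * 2 powr (real k * \<gamma>))" if "i \<in> {1..<k}" for i
      proof -
        have "fact k = real (k choose i) * (fact i * fact (k - i))"
          using that by (simp add: binomial_fact)
        also have "\<dots> \<le> 2 ^ k * (fact i * fact (k - i))"
          using binomial_le_pow2 [of k i] by (intro mult_right_mono) (auto simp flip: of_nat_le_iff)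
        finally have "fact k powr \<gamma> \<le> (2 ^ k * (fact i * fact (k - i))) powr \<gamma>"
          using \<gamma> by (intro powr_mono2) auto
        also have "\<dots> = 2 powr (real k * \<gamma>) * (fact i powr \<gamma> * fact (k - i) powr \<gamma>)"
          by (simp add: powr_mult powr_realpow [symmetric] powr_powr)
        finally have fk: "fact k powr \<gamma> \<le> 2 powr (real k * \<gamma>) * (fact i powr \<gamma> * fact (k - i) powr \<gamma>)" .
        have "B ^ i * B ^ (k - i) = B ^ k"
          using that by (simp add: power_add [symmetric])
        then have "c i * c (k - i) = \<beta> * \<beta> * B ^ k * (1 / (fact i powr \<gamma> * fact (k - i) powr \<gamma>))"
          by (simp add: c_def)
        also have "\<dots> \<le> \<beta> * \<beta> * B ^ k * (2 powr (real k * \<gamma>) / fact k powr \<gamma>)"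
          using fk \<beta> B(1) by (intro mult_left_mono) (auto simp: field_simps)
        also have "\<dots> = c k * (\<beta> * 2 powr (real k * \<gamma>))"
          by (simp add: c_def)
        finally show ?thesis .
      qed
      have "(\<Sum>i=1..<k. c i * c (k - i)) \<le> (\<Sum>i=1..<k. c k * (\<beta> * 2 powr (real k * \<gamma>)))"
        by (intro sum_mono term_le)
      also have "\<dots> = real (k - 1) * (c k * (\<beta> * 2 powr (real k * \<gamma>)))"
        by simp
      also have "\<dots> \<le> real k * (c k * (\<beta> * 2 powr (real k * \<gamma>)))"
        using c0 \<beta> by (intro mult_right_mono) auto
      also have "\<dots> = c k * (\<beta> * real k * 2 powr (real k * \<gamma>))"
        by simp
      also have "\<dots> \<le> c k * (2 powr (real k * \<alpha>) - 2)"
        using gap [OF that] c0 by (intro mult_left_mono)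
      finally show ?thesis
        using gap_pos [OF that] by (simp add: pos_divide_le_eq)
    qed
    show "summable (\<lambda>k. c k * x ^ k)" if "0 \<le> x" for x
    proof (rule summable_ratio_test)
      show "(1 / 2 :: real) < 1" by simp
      fix k assume k: "nat \<lceil>(2 * B * x) powr (1 / \<gamma>)\<rceil> \<le> k"
      have "(2 * B * x) powr (1 / \<gamma>) \<le> real (Suc k)"
        using k by linarith
      then have "((2 * B * x) powr (1 / \<gamma>)) powr \<gamma> \<le> real (Suc k) powr \<gamma>"
        using \<gamma> by (intro powr_mono2) auto
      moreover have "((2 * B * x) powr (1 / \<gamma>)) powr \<gamma> = 2 * B * x"
        using \<gamma> that B(1) by (simp add: powr_powr)
      ultimately have ratio: "B * x / real (Suc k) powr \<gamma> \<le> 1 / 2"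
        by (simp add: field_simps)
      have "fact (Suc k) powr \<gamma> = real (Suc k) powr \<gamma> * fact k powr \<gamma>"
        by (simp add: powr_mult)
      then have "c (Suc k) * x ^ Suc k = B * x / real (Suc k) powr \<gamma> * (c k * x ^ k)"
        by (simp add: c_def)
      also have "\<dots> \<le> 1 / 2 * (c k * x ^ k)"
        using ratio c0 that by (intro mult_right_mono) auto
      finally show "norm (c (Suc k) * x ^ Suc k) \<le> 1 / 2 * norm (c k * x ^ k)"
        using c0 that by simp
    qed
  qed
qed

section \<open>Extension and uniqueness, level by level\<close>

context completed_tensor_powers
begin

text \<open>Two lengths \<open>s\<close> and \<open>t\<close> with a common bound \<open>h\<close> serve both uses: \<open>h = b - a\<close> for an arbitrary
  intermediate point, and \<open>h = (b - a) / 2\<close> for the midpoint, where the power of \<open>2\<close> gained is what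
  makes the constants decay.\<close>
lemma mixed_norm_le:
  assumes "0 \<le> h" "0 \<le> s" "s \<le> h" "0 \<le> t" "t \<le> h" "0 < \<alpha>" "\<And>i. 0 \<le> c i"
    and "\<And>i. 0 < i \<Longrightarrow> i < k \<Longrightarrow> u i \<in> V i" "\<And>i. 0 < i \<Longrightarrow> i < k \<Longrightarrow> v i \<in> V i"
    and "\<And>i. 0 < i \<Longrightarrow> i < k \<Longrightarrow> N i (u i) \<le> c i * s powr (real i * \<alpha>)"
    and "\<And>i. 0 < i \<Longrightarrow> i < k \<Longrightarrow> N i (v i) \<le> c i * t powr (real i * \<alpha>)"
  shows "N k (mixed k u v) \<le> (\<Sum>i=1..<k. c i * c (k - i)) * h powr (real k * \<alpha>)"
proof -
  have "N k (mixed k u v) \<le> (\<Sum>i=1..<k. c i * c (k - i) * h powr (real k * \<alpha>))"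
    unfolding mixed_def
  proof (rule level.norm_sum_le)
    fix i assume i: "i \<in> {1..<k}"
    show "tens i (k - i) (u i) (v (k - i)) \<in> V k"
      using i assms by (intro tens_mem) auto
    have "N k (tens i (k - i) (u i) (v (k - i)))
        \<le> (c i * h powr (real i * \<alpha>)) * (c (k - i) * h powr (real (k - i) * \<alpha>))"
    proof (rule tens_norm_mono)
      have "N i (u i) \<le> c i * s powr (real i * \<alpha>)"
        using i by (intro assms) auto
      also have "\<dots> \<le> c i * h powr (real i * \<alpha>)"
        using assms by (intro mult_left_mono powr_mono2) auto
      finally show "N i (u i) \<le> c i * h powr (real i * \<alpha>)" .
      have "N (k - i) (v (k - i)) \<le> c (k - i) * t powr (real (k - i) * \<alpha>)"
        using i by (intro assms) auto
      also have "\<dots> \<le> c (k - i) * h powr (real (k - i) * \<alpha>)"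
        using assms by (intro mult_left_mono powr_mono2) auto
      finally show "N (k - i) (v (k - i)) \<le> c (k - i) * h powr (real (k - i) * \<alpha>)" .
    qed (use i assms in auto)
    also have "\<dots> = c i * c (k - i) * (h powr (real i * \<alpha>) * h powr (real (k - i) * \<alpha>))"
      by simp
    also have "h powr (real i * \<alpha>) * h powr (real (k - i) * \<alpha>) = h powr (real k * \<alpha>)"
    proof -
      have "real i * \<alpha> + real (k - i) * \<alpha> = real k * \<alpha>"
        using i by (simp add: of_nat_diff algebra_simps)
      then show ?thesis by (metis powr_add)
    qed
    finally show "N k (tens i (k - i) (u i) (v (k - i))) \<le> c i * c (k - i) * h powr (real k * \<alpha>)" .
  qed
  then show ?thesis
    by (simp add: sum_distrib_right)
qed

lemma chen_relation_gprod:
  "chen_relation tens T Y k \<longleftrightarrow> (\<forall>a b c. 0 \<le> a \<longrightarrow> a \<le> c \<longrightarrow> c \<le> b \<longrightarrow> b < T \<longrightarrow>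
    Y k a b = gprod (\<lambda>i. Y i a c) (\<lambda>i. Y i c b) k)"
  by (simp add: chen_relation_def gprod_def)

lemma chen_relation_split:
  assumes "chen_relation tens T Y k" "0 < k" "0 \<le> a" "a \<le> d" "d \<le> b" "b < T"
    and "Y 0 a d = unit" "Y 0 d b = unit" "Y k a d \<in> V k" "Y k d b \<in> V k"
  shows "Y k a b = Y k a d + Y k d b + mixed k (\<lambda>i. Y i a d) (\<lambda>i. Y i d b)"
proof -
  have "Y k a b = gprod (\<lambda>i. Y i a d) (\<lambda>i. Y i d b) k"
    using assms by (simp add: chen_relation_gprod)
  also have "\<dots> = Y k a d + Y k d b + mixed k (\<lambda>i. Y i a d) (\<lambda>i. Y i d b)"
    using assms by (intro gprod_unit_eq)
  finally show ?thesis .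
qed

lemma chen_relation_cong:
  assumes "chen_relation tens T Y k"
    and "\<And>i a b. i \<le> k \<Longrightarrow> 0 \<le> a \<Longrightarrow> a \<le> b \<Longrightarrow> b < T \<Longrightarrow> Y' i a b = Y i a b"
  shows "chen_relation tens T Y' k"
  unfolding chen_relation_def
proof (intro allI impI)
  fix a b c assume *: "0 \<le> a" "a \<le> c" "c \<le> b" "b < T"
  then have "Y' k a b = (\<Sum>i=0..k. tens i (k - i) (Y i a c) (Y (k - i) c b))"
    using assms by (simp add: chen_relation_def)
  also have "\<dots> = (\<Sum>i=0..k. tens i (k - i) (Y' i a c) (Y' (k - i) c b))"
    using * assms(2) by (intro sum.cong) auto
  finally show "Y' k a b = (\<Sum>i=0..k. tens i (k - i) (Y' i a c) (Y' (k - i) c b))" .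
qed

text \<open>By the cocycle identity at \<open>0 \<le> a \<le> d \<le> b\<close> the germ \<open>W 0 a b\<close> has defect \<open>- W a d b\<close>, so subtracting it
  from the increments of the sewn path produces exactly the mixed term that the Chen relation asks
  for. The constant \<open>C\<close> that sewing happens to give is then improved by bisection.\<close>
lemma extend_level:
  fixes Y :: "nat \<Rightarrow> real \<Rightarrow> real \<Rightarrow> 'v"
  assumes T: "0 < T" and k: "0 < k" and \<alpha>: "0 < \<alpha>" "1 < real k * \<alpha>"
    and mem: "\<And>i a b. i < k \<Longrightarrow> 0 \<le> a \<Longrightarrow> a \<le> b \<Longrightarrow> b < T \<Longrightarrow> Y i a b \<in> V i"
    and one: "\<And>a b. 0 \<le> a \<Longrightarrow> a \<le> b \<Longrightarrow> b < T \<Longrightarrow> Y 0 a b = unit"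
    and chen: "\<And>i. i < k \<Longrightarrow> chen_relation tens T Y i"
    and bound: "\<And>i a b. 0 < i \<Longrightarrow> i < k \<Longrightarrow> 0 \<le> a \<Longrightarrow> a \<le> b \<Longrightarrow> b < T \<Longrightarrow>
      N i (Y i a b) \<le> c i * (b - a) powr (real i * \<alpha>)"
    and c: "\<And>i. 0 \<le> c i"
  shows "\<exists>R. chen_relation tens T (Y(k := R)) k \<and> (\<forall>a b. 0 \<le> a \<longrightarrow> a \<le> b \<longrightarrow> b < T \<longrightarrow> R a b \<in> V k \<and>
    N k (R a b) \<le> (\<Sum>i=1..<k. c i * c (k - i)) / (2 powr (real k * \<alpha>) - 2) * (b - a) powr (real k * \<alpha>))"
proof -
  define W where "W = (\<lambda>a d b. mixed k (\<lambda>i. Y i a d) (\<lambda>i. Y i d b))"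
  define S where "S = (\<Sum>i=1..<k. c i * c (k - i))"
  have S: "0 \<le> S" unfolding S_def by (intro sum_nonneg mult_nonneg_nonneg c)
  have memW: "W a d b \<in> V k" if "0 \<le> a" "a \<le> d" "d \<le> b" "b < T" for a d b
    unfolding W_def using that by (intro mixed_mem mem) auto
  have W: "N k (W a d b) \<le> S * h powr (real k * \<alpha>)"
    if "0 \<le> a" "a \<le> d" "d \<le> b" "b < T" "d - a \<le> h" "b - d \<le> h" for a d b h
    unfolding W_def S_def using that \<alpha> c bound mem
    by (intro mixed_norm_le [where s = "d - a" and t = "b - d"]) auto
  have diag: "W 0 a a = 0" if "0 \<le> a" "a < T" for a
  proof -
    have "Y i a a = 0" if "0 < i" "i < k" for i
    proof -
      have "Y i a a \<in> V i" "N i (Y i a a) \<le> 0"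
        using bound [of i a a] mem [of i a a] that \<open>0 \<le> a\<close> \<open>a < T\<close> by auto
      then show ?thesis
        using level.norm_nonneg level.norm_eq_0_iff by (metis order_antisym)
    qed
    then show ?thesis
      using that mem unfolding W_def mixed_def by (intro sum.neutral) (auto intro!: tens_zero_right)
  qed
  have cocycle: "W 0 a d + W 0 d b = W 0 a b + W a d b"
    if "0 \<le> a" "a \<le> d" "d \<le> b" "b < T" for a d b
    unfolding W_def
  proof (rule mixed_cocycle)
    show "Y i 0 d = gprod (\<lambda>i. Y i 0 a) (\<lambda>i. Y i a d) i" if "i < k" for i
      using chen [OF that] \<open>0 \<le> a\<close> \<open>a \<le> d\<close> \<open>d \<le> b\<close> \<open>b < T\<close> by (simp add: chen_relation_gprod)
    show "Y i a b = gprod (\<lambda>i. Y i a d) (\<lambda>i. Y i d b) i" if "i < k" for i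
      using chen [OF that] \<open>0 \<le> a\<close> \<open>a \<le> d\<close> \<open>d \<le> b\<close> \<open>b < T\<close> by (simp add: chen_relation_gprod)
  qed (use that k one mem in auto)
  have defect: "N k (W 0 a b - W 0 a d - W 0 d b) \<le> S * (b - a) powr (real k * \<alpha>)"
    if "0 \<le> a" "a \<le> d" "d \<le> b" "b < T" for a d b
  proof -
    have "W 0 a b - W 0 a d - W 0 d b = - W a d b"
      using cocycle [OF that] by (simp add: algebra_simps)
    then show ?thesis
      using W [OF that, of "b - a"] memW [OF that] that by (simp add: level.norm_neg)
  qed
  obtain Z C where Z: "\<And>t. 0 \<le> t \<Longrightarrow> t < T \<Longrightarrow> Z t \<in> V k"
    and close: "\<And>a b. 0 \<le> a \<Longrightarrow> a \<le> b \<Longrightarrow> b < T \<Longrightarrow>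
      N k (Z b - Z a - W 0 a b) \<le> C * (b - a) powr (real k * \<alpha>)"
    using level.sewing [OF \<alpha>(2) S T memW [OF order_refl] diag defect] by blast
  define R where "R = (\<lambda>a b. Z b - Z a - W 0 a b)"
  have memR: "R a b \<in> V k" if "0 \<le> a" "a \<le> b" "b < T" for a b
    unfolding R_def using that by (intro level.diff_mem Z memW) auto
  have split: "R a b = R a d + R d b + W a d b" if "0 \<le> a" "a \<le> d" "d \<le> b" "b < T" for a d b
    using cocycle [OF that] by (simp add: R_def algebra_simps)
  show ?thesis
  proof (intro exI [of _ R] conjI allI impI)
    show "chen_relation tens T (Y(k := R)) k"
      unfolding chen_relation_gprod
    proof (intro allI impI)
      fix a b d assume *: "0 \<le> a" "a \<le> d" "d \<le> b" "b < T"
      have "gprod (\<lambda>i. (Y(k := R)) i a d) (\<lambda>i. (Y(k := R)) i d b) k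
          = R a d + R d b + mixed k (\<lambda>i. (Y(k := R)) i a d) (\<lambda>i. (Y(k := R)) i d b)"
        using k * one memR by (subst gprod_unit_eq) auto
      also have "mixed k (\<lambda>i. (Y(k := R)) i a d) (\<lambda>i. (Y(k := R)) i d b) = W a d b"
        unfolding W_def by (rule mixed_cong) auto
      finally show "(Y(k := R)) k a b = gprod (\<lambda>i. (Y(k := R)) i a d) (\<lambda>i. (Y(k := R)) i d b) k"
        using split [OF *] by simp
    qed
    show "N k (R a b) \<le> (\<Sum>i=1..<k. c i * c (k - i)) / (2 powr (real k * \<alpha>) - 2) * (b - a) powr (real k * \<alpha>)"
      if "0 \<le> a" "a \<le> b" "b < T" for a b
      unfolding S_def [symmetric]
    proof (rule level.midpoint_improvement [where R = R and W = W and T = T and S = C,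
          OF \<alpha>(2) memR split _ _ that])
      show "N k (W a ((a + b) / 2) b) \<le> S * ((b - a) / 2) powr (real k * \<alpha>)"
        if "0 \<le> a" "a \<le> b" "b < T" for a b
        using that by (intro W) (auto simp: field_simps)
      show "N k (R a b) \<le> C * (b - a) powr (real k * \<alpha>)" if "0 \<le> a" "a \<le> b" "b < T" for a b
        using close [OF that] by (simp add: R_def)
    qed auto
  qed (fact memR)
qed

text \<open>The previous lemma gives the next level as a mere existence statement, so the levels are added by
  dependent choice; \<open>good m Y\<close> says that \<open>Y\<close> is a solution up to level \<open>n + m\<close>. Later choices leave
  earlier levels unchanged, and the diagonal \<open>\<lambda>k. f k k\<close> collects them.\<close>
lemma extend_all_levels:
  fixes X :: "nat \<Rightarrow> real \<Rightarrow> real \<Rightarrow> 'v"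
  assumes T: "0 < T" and \<alpha>: "0 < \<alpha>" "1 < real (n + 1) * \<alpha>"
    and mem: "\<And>k a b. k \<le> n \<Longrightarrow> 0 \<le> a \<Longrightarrow> a \<le> b \<Longrightarrow> b < T \<Longrightarrow> X k a b \<in> V k"
    and one: "\<And>a b. 0 \<le> a \<Longrightarrow> a \<le> b \<Longrightarrow> b < T \<Longrightarrow> X 0 a b = unit"
    and chen: "\<And>k. k \<le> n \<Longrightarrow> chen_relation tens T X k"
    and bound: "\<And>k a b. 0 < k \<Longrightarrow> k \<le> n \<Longrightarrow> 0 \<le> a \<Longrightarrow> a \<le> b \<Longrightarrow> b < T \<Longrightarrow>
      N k (X k a b) \<le> c k * (b - a) powr (real k * \<alpha>)"
    and c: "\<And>k. 0 \<le> c k"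
    and c_step: "\<And>k. n < k \<Longrightarrow> (\<Sum>i=1..<k. c i * c (k - i)) / (2 powr (real k * \<alpha>) - 2) \<le> c k"
  shows "\<exists>Y. (\<forall>k\<le>n. Y k = X k) \<and> (\<forall>k. chen_relation tens T Y k) \<and>
    (\<forall>k a b. 0 \<le> a \<longrightarrow> a \<le> b \<longrightarrow> b < T \<longrightarrow> Y k a b \<in> V k \<and>
      (0 < k \<longrightarrow> N k (Y k a b) \<le> c k * (b - a) powr (real k * \<alpha>)))"
proof -
  define good where "good = (\<lambda>m Y. (\<forall>k\<le>n. Y k = X k) \<and> (\<forall>k\<le>n + m. chen_relation tens T Y k \<and>
    (\<forall>a b. 0 \<le> a \<longrightarrow> a \<le> b \<longrightarrow> b < T \<longrightarrow> Y k a b \<in> V k \<and>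
      (0 < k \<longrightarrow> N k (Y k a b) \<le> c k * (b - a) powr (real k * \<alpha>)))))"
  have "good 0 X"
    using mem chen bound by (auto simp: good_def)
  moreover have "\<exists>Y'. good (Suc m) Y' \<and> (\<forall>k\<le>n + m. Y' k = Y k)" if "good m Y" for m Y
  proof -
    let ?k = "n + Suc m"
    have Y: "\<And>k. k \<le> n \<Longrightarrow> Y k = X k" "\<And>k. k < ?k \<Longrightarrow> chen_relation tens T Y k"
      "\<And>k a b. k < ?k \<Longrightarrow> 0 \<le> a \<Longrightarrow> a \<le> b \<Longrightarrow> b < T \<Longrightarrow> Y k a b \<in> V k"
      "\<And>k a b. 0 < k \<Longrightarrow> k < ?k \<Longrightarrow> 0 \<le> a \<Longrightarrow> a \<le> b \<Longrightarrow> b < T \<Longrightarrow>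
        N k (Y k a b) \<le> c k * (b - a) powr (real k * \<alpha>)"
      using that by (auto simp: good_def)
    have "real (n + 1) * \<alpha> \<le> real ?k * \<alpha>"
      using \<alpha> by (intro mult_right_mono) auto
    then have large: "1 < real ?k * \<alpha>"
      using \<alpha> by linarith
    have k: "0 < ?k" by simp
    have oneY: "Y 0 a b = unit" if "0 \<le> a" "a \<le> b" "b < T" for a b
      using Y(1) [of 0] one that by simp
    have "\<exists>R. chen_relation tens T (Y(?k := R)) ?k \<and> (\<forall>a b. 0 \<le> a \<longrightarrow> a \<le> b \<longrightarrow> b < T \<longrightarrow> R a b \<in> V ?k \<and>
        N ?k (R a b) \<le> (\<Sum>i=1..<?k. c i * c (?k - i)) / (2 powr (real ?k * \<alpha>) - 2) * (b - a) powr (real ?k * \<alpha>))"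
      by (rule extend_level [OF T k \<alpha>(1) large Y(3) oneY Y(2,4) c])
    then obtain R where "chen_relation tens T (Y(?k := R)) ?k \<and> (\<forall>a b. 0 \<le> a \<longrightarrow> a \<le> b \<longrightarrow> b < T \<longrightarrow> R a b \<in> V ?k \<and>
        N ?k (R a b) \<le> (\<Sum>i=1..<?k. c i * c (?k - i)) / (2 powr (real ?k * \<alpha>) - 2) * (b - a) powr (real ?k * \<alpha>))"
      ..
    then have R_chen: "chen_relation tens T (Y(?k := R)) ?k"
      and R: "\<forall>a b. 0 \<le> a \<longrightarrow> a \<le> b \<longrightarrow> b < T \<longrightarrow> R a b \<in> V ?k \<and> N ?k (R a b)
        \<le> (\<Sum>i=1..<?k. c i * c (?k - i)) / (2 powr (real ?k * \<alpha>) - 2) * (b - a) powr (real ?k * \<alpha>)"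
      by (rule conjunct1, rule conjunct2)
    let ?Y = "Y(?k := R)"
    have "chen_relation tens T ?Y k" if "k \<le> ?k" for k
    proof (cases "k = ?k")
      case False
      then show ?thesis
        using that by (intro chen_relation_cong [OF Y(2)]) auto
    qed (use R_chen in simp)
    moreover have "N ?k (R a b) \<le> c ?k * (b - a) powr (real ?k * \<alpha>)"
      if "0 \<le> a" "a \<le> b" "b < T" for a b
    proof (rule order_trans)
      show "N ?k (R a b) \<le> (\<Sum>i=1..<?k. c i * c (?k - i)) / (2 powr (real ?k * \<alpha>) - 2)
          * (b - a) powr (real ?k * \<alpha>)"
        using R that by blast
    qed (intro mult_right_mono c_step; simp)
    ultimately have "good (Suc m) ?Y"
      using Y R by (auto simp: good_def le_Suc_eq)
    then show ?thesis
      by (intro exI [of _ ?Y]) auto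
  qed
  ultimately obtain f where f: "\<And>m. good m (f m)" "\<And>m k. k \<le> n + m \<Longrightarrow> f (Suc m) k = f m k"
    using dependent_nat_choice [of good "\<lambda>m Y Y'. \<forall>k\<le>n + m. Y' k = Y k"] by metis
  have stable: "f (m + d) k = f m k" if "k \<le> n + m" for m d k
    using that f(2) by (induction d) auto
  define Y where "Y = (\<lambda>k. f k k)"
  have Y: "Y i = f k i" if "i \<le> k" for i k
    using stable [of i i "k - i"] that by (simp add: Y_def)
  show ?thesis
  proof (intro exI [of _ Y] conjI allI impI)
    show "Y k = X k" if "k \<le> n" for k
      using f(1) [of k] that by (simp add: good_def Y_def)
    have f_k: "chen_relation tens T (f k) k"
      "\<And>a b. 0 \<le> a \<Longrightarrow> a \<le> b \<Longrightarrow> b < T \<Longrightarrow> f k k a b \<in> V k"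
      "\<And>a b. 0 < k \<Longrightarrow> 0 \<le> a \<Longrightarrow> a \<le> b \<Longrightarrow> b < T \<Longrightarrow>
        N k (f k k a b) \<le> c k * (b - a) powr (real k * \<alpha>)" for k
      using f(1) [of k] unfolding good_def by auto
    show "chen_relation tens T Y k" for k
      using f_k(1) by (rule chen_relation_cong) (simp add: Y)
    show "Y k a b \<in> V k" if "0 \<le> a" "a \<le> b" "b < T" for k a b
      using f_k(2) that by (simp add: Y_def)
    show "N k (Y k a b) \<le> c k * (b - a) powr (real k * \<alpha>)"
      if "0 < k" "0 \<le> a" "a \<le> b" "b < T" for k a b
      using f_k(3) that by (simp add: Y_def)
  qed
qed

lemma extension_unique:
  fixes Y Z :: "nat \<Rightarrow> real \<Rightarrow> real \<Rightarrow> 'v"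
  assumes \<theta>: "1 < \<theta>"
    and memY: "\<And>k a b. 0 \<le> a \<Longrightarrow> a \<le> b \<Longrightarrow> b < T \<Longrightarrow> Y k a b \<in> V k"
    and memZ: "\<And>k a b. 0 \<le> a \<Longrightarrow> a \<le> b \<Longrightarrow> b < T \<Longrightarrow> Z k a b \<in> V k"
    and one: "\<And>a b. 0 \<le> a \<Longrightarrow> a \<le> b \<Longrightarrow> b < T \<Longrightarrow> Y 0 a b = unit"
    and low: "\<And>k a b. k \<le> n \<Longrightarrow> 0 \<le> a \<Longrightarrow> a \<le> b \<Longrightarrow> b < T \<Longrightarrow> Y k a b = Z k a b"
    and chen: "\<And>k. chen_relation tens T Y k" "\<And>k. chen_relation tens T Z k"
    and boundY: "\<And>k a b. n < k \<Longrightarrow> 0 \<le> a \<Longrightarrow> a \<le> b \<Longrightarrow> b < T \<Longrightarrow> N k (Y k a b) \<le> C * (b - a) powr \<theta>"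
    and boundZ: "\<And>k a b. n < k \<Longrightarrow> 0 \<le> a \<Longrightarrow> a \<le> b \<Longrightarrow> b < T \<Longrightarrow> N k (Z k a b) \<le> C' * (b - a) powr \<theta>"
    and ab: "0 \<le> a" "a \<le> b" "b < T"
  shows "Y k a b = Z k a b"
  using ab
proof (induction k arbitrary: a b rule: less_induct)
  case (less k)
  show ?case
  proof (cases "k \<le> n")
    case True
    then show ?thesis using low less.prems by blast
  next
    case False
    let ?R = "\<lambda>a b. Y k a b - Z k a b"
    have oneZ: "Z 0 a b = unit" if "0 \<le> a" "a \<le> b" "b < T" for a b
      using low [of 0 a b] one [of a b] that by simp
    have memR: "?R a b \<in> V k" if "0 \<le> a" "a \<le> b" "b < T" for a b
      using that memY memZ by (intro level.diff_mem)
    have "N k (?R a b) \<le> 0 / (2 powr \<theta> - 2) * (b - a) powr \<theta>"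
    proof (rule level.midpoint_improvement [where T = T and W = "\<lambda>a d b. 0" and S = "C + C'"])
      fix a d b assume *: "0 \<le> a" "a \<le> d" "d \<le> b" "b < T"
      have "Y k a b = Y k a d + Y k d b + mixed k (\<lambda>i. Y i a d) (\<lambda>i. Y i d b)"
        using chen(1) * False one memY by (intro chen_relation_split) auto
      moreover have "Z k a b = Z k a d + Z k d b + mixed k (\<lambda>i. Z i a d) (\<lambda>i. Z i d b)"
        using chen(2) * False oneZ memZ by (intro chen_relation_split) auto
      moreover have "mixed k (\<lambda>i. Y i a d) (\<lambda>i. Y i d b) = mixed k (\<lambda>i. Z i a d) (\<lambda>i. Z i d b)"
        using less.IH * by (intro mixed_cong) auto
      ultimately show "?R a b = ?R a d + ?R d b + 0"
        by simp
    next
      fix a b assume *: "0 \<le> a" "a \<le> b" "b < T"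
      have "N k (?R a b) \<le> N k (Y k a b) + N k (Z k a b)"
        using * memY memZ by (intro level.norm_diff_le)
      also have "\<dots> \<le> C * (b - a) powr \<theta> + C' * (b - a) powr \<theta>"
        using * False by (intro add_mono boundY boundZ) auto
      finally show "N k (?R a b) \<le> (C + C') * (b - a) powr \<theta>"
        by (simp add: algebra_simps)
    qed (use \<theta> memR less.prems in auto)
    then have "N k (?R a b) = 0"
      using level.norm_nonneg [OF memR] less.prems by (simp add: order_antisym)
    then show ?thesis
      using level.norm_eq_0_iff [OF memR] less.prems by simp
  qed
qed

end

section \<open>The extension theorem\<close>

theorem mainTheorem6:
  fixes p :: "nat \<Rightarrow> 'e::banach tensor_algebra \<Rightarrow> real"
    and V :: "nat \<Rightarrow> 'v::real_vector set"
    and N :: "nat \<Rightarrow> 'v \<Rightarrow> real"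
    and \<iota> :: "nat \<Rightarrow> 'e tensor_algebra \<Rightarrow> 'v"
    and tens :: "nat \<Rightarrow> nat \<Rightarrow> 'v \<Rightarrow> 'v \<Rightarrow> 'v"
    and T \<alpha> M :: real and n :: nat
    and X :: "nat \<Rightarrow> real \<Rightarrow> real \<Rightarrow> 'v"
  assumes "completed_tensor_powers p V N \<iota> tens"
    and "0 < T"
    and "\<alpha> > 1 / (real n + 1)"
    and "\<And>k a b. k \<le> n \<Longrightarrow> 0 \<le> a \<Longrightarrow> a \<le> b \<Longrightarrow> b < T \<Longrightarrow> X k a b \<in> V k"
    and "\<And>a b. 0 \<le> a \<Longrightarrow> a \<le> b \<Longrightarrow> b < T \<Longrightarrow> X 0 a b = \<iota> 0 (pure_tensor [])"
    and "\<And>k. k \<le> n \<Longrightarrow> chen_relation tens T X k"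
    and "\<And>k a b. k \<le> n \<Longrightarrow> 0 \<le> a \<Longrightarrow> a \<le> b \<Longrightarrow> b < T \<Longrightarrow>
      N k (X k a b) \<le> M * rpow \<bar>b - a\<bar> (real k * \<alpha>)"
  shows "(\<exists>Y. multiplicative_extension V N tens T \<alpha> n X Y) \<and>
    (\<forall>Y Z. multiplicative_extension V N tens T \<alpha> n X Y \<longrightarrow>
      multiplicative_extension V N tens T \<alpha> n X Z \<longrightarrow>
      (\<forall>k a b. 0 \<le> a \<longrightarrow> a \<le> b \<longrightarrow> b < T \<longrightarrow> Y k a b = Z k a b))"
proof -
  interpret completed_tensor_powers p V N \<iota> tens
    by (fact assms(1))
  have "0 < 1 / (real n + 1)"
    by simp
  with assms(3) have \<alpha>: "0 < \<alpha>"
    by linarith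
  let ?\<theta> = "real (n + 1) * \<alpha>"
  have \<theta>: "1 < ?\<theta>"
    using assms(3) by (simp add: pos_divide_less_eq mult.commute add.commute)
  have rpow: "rpow \<bar>b - a\<bar> (real k * \<alpha>) = (b - a) powr (real k * \<alpha>)" if "0 < k" "a \<le> b" for a b k
    using that \<alpha> by (simp add: rpow_def)
  have "\<exists>Y. multiplicative_extension V N tens T \<alpha> n X Y"
  proof -
    obtain c where c: "\<And>k. 0 \<le> c k" "\<And>k. 0 < k \<Longrightarrow> k \<le> n \<Longrightarrow> M \<le> c k"
      "\<And>k. n < k \<Longrightarrow> (\<Sum>i=1..<k. c i * c (k - i)) / (2 powr (real k * \<alpha>) - 2) \<le> c k"
      "\<And>x. 0 \<le> x \<Longrightarrow> summable (\<lambda>k. c k * x ^ k)"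
      by (rule extension_constants [OF \<alpha> \<theta>, where M = M]) (rule that)
    have bound: "N k (X k a b) \<le> c k * (b - a) powr (real k * \<alpha>)"
      if "0 < k" "k \<le> n" "0 \<le> a" "a \<le> b" "b < T" for k a b
    proof -
      have "N k (X k a b) \<le> M * (b - a) powr (real k * \<alpha>)"
        using assms(7) [of k a b] rpow [of k a b] that by simp
      also have "\<dots> \<le> c k * (b - a) powr (real k * \<alpha>)"
        using c(2) that by (intro mult_right_mono) auto
      finally show ?thesis .
    qed
    have "\<exists>Y. (\<forall>k\<le>n. Y k = X k) \<and> (\<forall>k. chen_relation tens T Y k) \<and>
        (\<forall>k a b. 0 \<le> a \<longrightarrow> a \<le> b \<longrightarrow> b < T \<longrightarrow> Y k a b \<in> V k \<and>
          (0 < k \<longrightarrow> N k (Y k a b) \<le> c k * (b - a) powr (real k * \<alpha>)))"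
      by (rule extend_all_levels [OF assms(2) \<alpha> \<theta> assms(4-6) bound c(1,3)])
    then obtain Y where Y: "\<And>k. k \<le> n \<Longrightarrow> Y k = X k" "\<And>k. chen_relation tens T Y k"
      and Y_mem: "\<And>k a b. 0 \<le> a \<Longrightarrow> a \<le> b \<Longrightarrow> b < T \<Longrightarrow> Y k a b \<in> V k"
      and Y_bound: "\<And>k a b. 0 < k \<Longrightarrow> 0 \<le> a \<Longrightarrow> a \<le> b \<Longrightarrow> b < T \<Longrightarrow>
        N k (Y k a b) \<le> c k * (b - a) powr (real k * \<alpha>)"
      by blast
    \<comment> \<open>Since \<open>b - a \<le> T\<close>, level \<open>n + 1 + j\<close> is at most \<open>(b - a) powr ((n + 1) * \<alpha>)\<close> times \<open>c (n + 1 + j) * x ^ j\<close>.\<close>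
    define x where "x = T powr \<alpha>"
    have x: "0 < x" using assms(2) by (simp add: x_def)
    define g where "g = (\<lambda>j. c (n + 1 + j) * x ^ j)"
    have "summable (\<lambda>j. c (j + (n + 1)) * x ^ (j + (n + 1)))"
      using c(4) [of x] x by (subst summable_iff_shift) simp
    then have "summable (\<lambda>j. c (j + (n + 1)) * x ^ (j + (n + 1)) / x ^ (n + 1))"
      by (rule summable_divide)
    then have g: "summable g"
      using x by (simp add: g_def power_add add_ac)
    have tail: "N (n + 1 + j) (Y (n + 1 + j) a b) \<le> (b - a) powr ?\<theta> * g j"
      if "0 \<le> a" "a \<le> b" "b < T" for a b j
    proof -
      have "real (n + 1 + j) * \<alpha> = ?\<theta> + real j * \<alpha>"
        by (simp add: algebra_simps)
      then have "(b - a) powr (real (n + 1 + j) * \<alpha>) = (b - a) powr ?\<theta> * (b - a) powr (real j * \<alpha>)"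
        by (metis powr_add)
      also have "\<dots> \<le> (b - a) powr ?\<theta> * T powr (real j * \<alpha>)"
        using that \<alpha> by (intro mult_left_mono powr_mono2) auto
      also have "T powr (real j * \<alpha>) = x ^ j"
        using assms(2) by (simp add: x_def powr_realpow [symmetric] powr_powr mult.commute)
      finally have "c (n + 1 + j) * (b - a) powr (real (n + 1 + j) * \<alpha>)
          \<le> c (n + 1 + j) * ((b - a) powr ?\<theta> * x ^ j)"
        using c(1) by (rule mult_left_mono)
      then show ?thesis
        using Y_bound [of "n + 1 + j" a b] that by (simp add: g_def mult_ac)
    qed
    have "summable (\<lambda>j. N (n + 1 + j) (Y (n + 1 + j) a b)) \<and>
        suminf (\<lambda>j. N (n + 1 + j) (Y (n + 1 + j) a b)) \<le> suminf g * rpow \<bar>b - a\<bar> ?\<theta>"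
      if ab: "0 \<le> a" "a \<le> b" "b < T" for a b
    proof -
      have sg: "summable (\<lambda>j. (b - a) powr ?\<theta> * g j)"
        using g by (rule summable_mult)
      have s: "summable (\<lambda>j. N (n + 1 + j) (Y (n + 1 + j) a b))"
        using tail [OF ab] level.norm_nonneg [OF Y_mem [OF ab]]
        by (intro summable_comparison_test' [OF sg, of 0]) (simp del: add_Suc_right add_Suc)
      have "suminf (\<lambda>j. N (n + 1 + j) (Y (n + 1 + j) a b)) \<le> suminf (\<lambda>j. (b - a) powr ?\<theta> * g j)"
        using tail [OF ab] s sg by (rule suminf_le)
      also have "\<dots> = suminf g * (b - a) powr ?\<theta>"
        unfolding suminf_mult [OF g] by (rule mult.commute)
      finally show ?thesis
        using s rpow [of "n + 1" a b] ab by simp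
    qed
    then show ?thesis
      unfolding multiplicative_extension_def using Y Y_mem by (intro exI [of _ Y] conjI) auto
  qed
  moreover have "Y k a b = Z k a b"
    if Y: "multiplicative_extension V N tens T \<alpha> n X Y"
      and Z: "multiplicative_extension V N tens T \<alpha> n X Z" and ab: "0 \<le> a" "a \<le> b" "b < T"
    for Y Z k a b
  proof -
    have level_bound: "\<exists>C. \<forall>k a b. n < k \<longrightarrow> 0 \<le> a \<longrightarrow> a \<le> b \<longrightarrow> b < T \<longrightarrow>
        N k (Y k a b) \<le> C * (b - a) powr ?\<theta>"
      if ext: "multiplicative_extension V N tens T \<alpha> n X Y" for Y
    proof -
      from ext have mem: "\<And>k a b. 0 \<le> a \<Longrightarrow> a \<le> b \<Longrightarrow> b < T \<Longrightarrow> Y k a b \<in> V k"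
        unfolding multiplicative_extension_def by blast
      from ext obtain C where C: "\<And>a b. 0 \<le> a \<Longrightarrow> a \<le> b \<Longrightarrow> b < T \<Longrightarrow>
          summable (\<lambda>j. N (n + 1 + j) (Y (n + 1 + j) a b)) \<and>
          suminf (\<lambda>j. N (n + 1 + j) (Y (n + 1 + j) a b)) \<le> C * rpow \<bar>b - a\<bar> ?\<theta>"
        unfolding multiplicative_extension_def by blast
      have "N k (Y k a b) \<le> C * (b - a) powr ?\<theta>"
        if "n < k" "0 \<le> a" "a \<le> b" "b < T" for k a b
      proof -
        let ?s = "\<lambda>j. N (n + 1 + j) (Y (n + 1 + j) a b)"
        have "sum ?s {k - (n + 1)} \<le> suminf ?s"
          using C that level.norm_nonneg mem by (intro sum_le_suminf) auto
        then have "N k (Y k a b) \<le> suminf ?s"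
          using that by simp
        also have "\<dots> \<le> C * (b - a) powr ?\<theta>"
          using C [of a b] rpow [of "n + 1" a b] that by simp
        finally show ?thesis .
      qed
      then show ?thesis by blast
    qed
    obtain C where C: "\<And>k a b. n < k \<Longrightarrow> 0 \<le> a \<Longrightarrow> a \<le> b \<Longrightarrow> b < T \<Longrightarrow>
        N k (Y k a b) \<le> C * (b - a) powr ?\<theta>"
      using level_bound [OF Y] by blast
    obtain C' where C': "\<And>k a b. n < k \<Longrightarrow> 0 \<le> a \<Longrightarrow> a \<le> b \<Longrightarrow> b < T \<Longrightarrow>
        N k (Z k a b) \<le> C' * (b - a) powr ?\<theta>"
      using level_bound [OF Z] by blast
    show ?thesis
    proof (rule extension_unique [where T = T and n = n and \<theta> = ?\<theta> and C = C and C' = C'])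
      show "Y 0 a b = unit" if "0 \<le> a" "a \<le> b" "b < T" for a b
        using Y that assms(5) by (simp add: multiplicative_extension_def)
      show "Y k a b = Z k a b" if "k \<le> n" "0 \<le> a" "a \<le> b" "b < T" for k a b
        using Y Z that by (simp add: multiplicative_extension_def)
    qed (use Y Z ab \<theta> C C' in \<open>auto simp: multiplicative_extension_def\<close>)
  qed
  ultimately show ?thesis
    by blast
qed

end
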